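(* Let $(\boldsymbol{u}^{n+1},p^{n+1},\boldsymbol{\xi}^{n+1},\boldsymbol{\eta}^{n+1})$, $0\le n\le N-1$, denote the solution of the decoupled time-discrete (backward Euler) scheme (F$_{\Delta t}$), (S$_{\Delta t}$) described in the context, with Robin parameters $L_1$ (fluid) and $L_2$ (structure). If $L_1=L_2$, the scheme is unconditionally stable: with no restriction on $\Delta t>0$, the following a priori energy estimate holds: $$\mathcal{E}^N+\sum_{n=1}^N\mathcal{D}^n+\mathcal{I}^N\le\mathcal{E}^0+\mathcal{I}^0,$$ where $\mathcal{E}^n,\mathcal{D}^n,\mathcal{I}^n$ are defined in the context.
   Context: Setting. $\Omega_f,\Omega_s\subset\mathbb{R}^d$, $d\in\{2,3\}$, are fixed regular bounded domains (fluid and structure) sharing an interface $\Gamma$; $\boldsymbol{n}_f$ and $\boldsymbol{n}_s$ are their outward unit normals, with $\boldsymbol{n}_f=-\boldsymbol{n}_s$ on $\Gamma$. The constants $\rho_f,\mu_f,\rho_s,\mu_s,\lambda_s$ are positive, and $L_1,L_2>0$ are constants (Robin parameters). On the parts of $\partial\Omega_f$ and $\partial\Omega_s$ other than $\Gamma$, either homogeneous Dirichlet conditions ($\boldsymbol{u}=\boldsymbol{0}$, resp. $\boldsymbol{\eta}=\boldsymbol{\xi}=\boldsymbol{0}$) or homogeneous natural (zero-traction) conditions are imposed. Put $\mathbb{D}(\boldsymbol{v})=\frac12(\nabla\boldsymbol{v}+(\nabla\boldsymbol{v})^T)$, $\boldsymbol{\sigma}_f(\boldsymbol{u},p)=-p\boldsymbol{I}+2\mu_f\mathbb{D}(\boldsymbol{u})$,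 $\boldsymbol{\sigma}_s(\boldsymbol{\eta})=2\mu_s\mathbb{D}(\boldsymbol{\eta})+\lambda_s(\nabla\cdot\boldsymbol{\eta})\boldsymbol{I}$. Let $T>0$, $N\ge1$, $\Delta t=T/N$. The functions with superscript $n$ are functions of space only (approximations at $t_n=n\Delta t$); $\boldsymbol{\sigma}_f^n=\boldsymbol{\sigma}_f(\boldsymbol{u}^n,p^n)$, $\boldsymbol{\sigma}_s^n=\boldsymbol{\sigma}_s(\boldsymbol{\eta}^n)$; superscript $0$ denotes given initial data. Solutions are assumed regular enough that $\boldsymbol{u}^n,\boldsymbol{\xi}^n,\boldsymbol{\sigma}_f^n\boldsymbol{n}_f,\boldsymbol{\sigma}_s^n\boldsymbol{n}_s\in L^2(\Gamma)$. (F$_{\Delta t}$) Fluid step: find $\boldsymbol{u}^{n+1},p^{n+1}$ with $$\rho_f\frac{\boldsymbol{u}^{n+1}-\boldsymbol{u}^n}{\Delta t}-\nabla\cdot\boldsymbol{\sigma}_f^{n+1}=0,\qquad\nabla\cdot\boldsymbol{u}^{n+1}=0\quad\text{in }\Omega_f,$$ $$L_1\boldsymbol{u}^{n+1}+\boldsymbol{\sigma}_f^{n+1}\boldsymbol{n}_f=\tfrac{L_1}2\boldsymbol{u}^n+\tfrac{L_1}2\boldsymbol{\xi}^n+\tfrac12\boldsymbol{\sigma}_f^n\boldsymbol{n}_f+\tfrac12\boldsymbol{\sigma}_s^n\boldsymbol{n}_f\quad\text{on }\Gamma.$$ (S$_{\Delta t}$) Structure step: find $\boldsymbol{\eta}^{n+1}$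 and $\boldsymbol{\xi}^{n+1}=(\boldsymbol{\eta}^{n+1}-\boldsymbol{\eta}^n)/\Delta t$ with $$\rho_s\frac{\boldsymbol{\xi}^{n+1}-\boldsymbol{\xi}^n}{\Delta t}-\nabla\cdot\boldsymbol{\sigma}_s^{n+1}=0\quad\text{in }\Omega_s,$$ $$L_2\boldsymbol{\xi}^{n+1}+\boldsymbol{\sigma}_s^{n+1}\boldsymbol{n}_s=\tfrac{L_2}2\boldsymbol{u}^n+\tfrac{L_2}2\boldsymbol{\xi}^n+\tfrac12\boldsymbol{\sigma}_f^n\boldsymbol{n}_s+\tfrac12\boldsymbol{\sigma}_s^n\boldsymbol{n}_s\quad\text{on }\Gamma.$$ Norms: $\|\cdot\|_f,\|\cdot\|_s,\|\cdot\|_\Gamma$ are the $L^2$ norms on $\Omega_f,\Omega_s,\Gamma$, and $\|\boldsymbol{\eta}\|_E^2=2\mu_s\|\mathbb{D}(\boldsymbol{\eta})\|_s^2+\lambda_s\|\nabla\cdot\boldsymbol{\eta}\|_s^2$. Quantities: $$\mathcal{E}^n=\tfrac{\rho_s}2\|\boldsymbol{\xi}^n\|_s^2+\tfrac12\|\boldsymbol{\eta}^n\|_E^2+\tfrac{\rho_f}2\|\boldsymbol{u}^n\|_f^2,$$ $$\mathcal{D}^n=\mu_f\Delta t\|\mathbb{D}(\boldsymbol{u}^n)\|_f^2+\tfrac{\rho_s}2\|\boldsymbol{\xi}^n-\boldsymbol{\xi}^{n-1}\|_s^2+\tfrac12\|\boldsymbol{\eta}^n-\boldsymbol{\eta}^{n-1}\|_E^2+\tfrac{\rho_f}2\|\boldsymbol{u}^n-\boldsymbol{u}^{n-1}\|_f^2,$$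 $$\mathcal{I}^n=\tfrac{L_1\Delta t}2\|\boldsymbol{u}^n\|_\Gamma^2+\tfrac{L_2\Delta t}2\|\boldsymbol{\xi}^n\|_\Gamma^2+\tfrac{\Delta t}{2L_1}\|\boldsymbol{\sigma}_f^n\boldsymbol{n}_f\|_\Gamma^2+\tfrac{\Delta t}{2L_2}\|\boldsymbol{\sigma}_s^n\boldsymbol{n}_s\|_\Gamma^2.$$ *)

theory Defs
  imports "HOL-Analysis.Analysis"
begin

section \<open>Surface measure, outward normal, regular domains\<close>

text \<open>
  Hausdorff measure, normalised so that it is the usual \<open>s\<close>-dimensional area on smooth
  \<open>s\<close>-dimensional surfaces. Boundedness of the covering sets is required explicitly because
  \<^const>\<open>diameter\<close> has no meaningful value on unbounded sets. The dimension \<open>s\<close> is positive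
  wherever this is used.
\<close>

definition hausdorff_pre :: "nat \<Rightarrow> real \<Rightarrow> 'a::metric_space set \<Rightarrow> ennreal" where
  "hausdorff_pre s \<delta> A =
    (INF C \<in> {C :: nat \<Rightarrow> 'a set. A \<subseteq> (\<Union>i. C i) \<and> (\<forall>i. bounded (C i) \<and> diameter (C i) \<le> \<delta>)}.
       \<Sum>i. ennreal (unit_ball_vol (real s) * (diameter (C i) / 2) ^ s))"

definition hausdorff_outer :: "nat \<Rightarrow> 'a::metric_space set \<Rightarrow> ennreal" where
  "hausdorff_outer s A = (SUP \<delta> \<in> {0<..}. hausdorff_pre s \<delta> A)"

definition hausdorff_measure :: "nat \<Rightarrow> 'a::metric_space measure" where
  "hausdorff_measure s = measure_of UNIV (sets borel) (hausdorff_outer s)"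

definition surface_measure :: "(real^'n::finite) set \<Rightarrow> (real^'n) measure" where
  "surface_measure B = restrict_space (hausdorff_measure (CARD('n) - 1)) B"

text \<open>
  Rows of a Jacobian are indexed by components: \<open>(\<nabla>v)$i$j = \<partial>\<^sub>j v\<^sub>i\<close>, so that
  \<open>div v = trace (\<nabla>v)\<close> and the divergence of a tensor field is taken row by row.
\<close>

definition grad :: "(real^'n \<Rightarrow> real^'n) \<Rightarrow> real^'n \<Rightarrow> real^'n^'n" where
  "grad v x = jacobian v (at x)"

definition C1_field :: "(real^'n \<Rightarrow> real^'n) \<Rightarrow> bool" where
  "C1_field v \<longleftrightarrow> (\<forall>x. v differentiable (at x)) \<and> continuous_on UNIV (grad v)"

definition C1_tensor :: "(real^'n \<Rightarrow> real^'n^'n) \<Rightarrow> bool" where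
  "C1_tensor S \<longleftrightarrow> (\<forall>i. C1_field (\<lambda>x. S x $ i))"

definition div_tensor :: "(real^'n \<Rightarrow> real^'n^'n) \<Rightarrow> real^'n \<Rightarrow> real^'n" where
  "div_tensor S x = (\<chi> i. trace (grad (\<lambda>y. S y $ i) x))"

text \<open>
  The outward unit normal is taken in the sense of De Giorgi: it is the unit field \<open>\<nu>\<close> on the
  boundary for which the distributional gradient of the indicator function of \<open>\<Omega>\<close> is
  \<open>-\<nu>\<close> times surface measure. It is unique up to null sets of the surface measure, and on a
  Lipschitz domain it is the classical outward unit normal. Test fields need no compact support
  since \<open>\<Omega>\<close> is bounded.
\<close>

definition outward_unit_normal :: "(real^'n::finite) set \<Rightarrow> (real^'n \<Rightarrow> real^'n) \<Rightarrow> bool" where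
  "outward_unit_normal \<Omega> \<nu> \<longleftrightarrow>
     \<nu> \<in> borel_measurable (surface_measure (frontier \<Omega>)) \<and>
     (AE x in surface_measure (frontier \<Omega>). norm (\<nu> x) = 1) \<and>
     (\<forall>v. C1_field v \<longrightarrow>
        (\<integral>x. trace (grad v x) \<partial>lebesgue_on \<Omega>) =
        (\<integral>x. v x \<bullet> \<nu> x \<partial>surface_measure (frontier \<Omega>)))"

text \<open>
  This includes all bounded Lipschitz domains, in particular domains with corners.
\<close>

definition regular_domain :: "(real^'n::finite) set \<Rightarrow> bool" where
  "regular_domain \<Omega> \<longleftrightarrow>
     open \<Omega> \<and> connected \<Omega> \<and> \<Omega> \<noteq> {} \<and> bounded \<Omega> \<and>
     emeasure (hausdorff_measure (CARD('n) - 1)) (frontier \<Omega>) < \<infinity> \<and>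
     (\<exists>\<nu>. outward_unit_normal \<Omega> \<nu>)"

definition boundary_partition ::
  "(real^'n::finite) set \<Rightarrow> (real^'n) set \<Rightarrow> (real^'n) set \<Rightarrow> (real^'n) set \<Rightarrow> bool" where
  "boundary_partition \<Omega> \<Gamma> \<Gamma>D \<Gamma>N \<longleftrightarrow>
     \<Gamma> \<in> sets borel \<and> \<Gamma>D \<in> sets borel \<and> \<Gamma>N \<in> sets borel \<and>
     \<Gamma> \<inter> \<Gamma>D = {} \<and> \<Gamma> \<inter> \<Gamma>N = {} \<and> \<Gamma>D \<inter> \<Gamma>N = {} \<and>
     \<Gamma> \<union> \<Gamma>D \<union> \<Gamma>N = frontier \<Omega>"

section \<open>Function spaces and traces\<close>

definition square_integrable :: "'a measure \<Rightarrow> ('a \<Rightarrow> 'b::euclidean_space) \<Rightarrow> bool" where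
  "square_integrable M f \<longleftrightarrow> f \<in> borel_measurable M \<and> integrable M (\<lambda>x. (norm (f x))\<^sup>2)"

definition l2norm :: "'a measure \<Rightarrow> ('a \<Rightarrow> 'b::euclidean_space) \<Rightarrow> real" where
  "l2norm M f = sqrt (\<integral>x. (norm (f x))\<^sup>2 \<partial>M)"

definition l2_converges ::
  "'a measure \<Rightarrow> (nat \<Rightarrow> 'a \<Rightarrow> 'b::euclidean_space) \<Rightarrow> ('a \<Rightarrow> 'b) \<Rightarrow> bool" where
  "l2_converges M F f \<longleftrightarrow>
     (\<forall>k. square_integrable M (F k)) \<and> square_integrable M f \<and>
     (\<lambda>k. l2norm M (\<lambda>x. F k x - f x)) \<longlonglongrightarrow> 0"

text \<open>
  \<open>v \<in> H\<^sup>1(\<Omega>)\<close> with weak gradient \<open>G\<close> and boundary trace \<open>g\<close>: \<open>H\<^sup>1(\<Omega>)\<close> is the completion of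
  the functions that are smooth up to the boundary, and the gradient and the trace are the
  continuous extensions of the classical gradient and of restriction to the boundary.
  \<open>G\<close> and \<open>g\<close> are determined by \<open>v\<close> up to null sets.
\<close>

definition H1_field ::
  "(real^'n::finite) set \<Rightarrow> (real^'n \<Rightarrow> real^'n) \<Rightarrow> (real^'n \<Rightarrow> real^'n^'n) \<Rightarrow> (real^'n \<Rightarrow> real^'n) \<Rightarrow> bool" where
  "H1_field \<Omega> v G g \<longleftrightarrow>
     (\<exists>\<phi>. (\<forall>k::nat. C1_field (\<phi> k)) \<and>
          l2_converges (lebesgue_on \<Omega>) \<phi> v \<and>
          l2_converges (lebesgue_on \<Omega>) (\<lambda>k. grad (\<phi> k)) G \<and>
          l2_converges (surface_measure (frontier \<Omega>)) \<phi> g)"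

text \<open>
  \<open>\<sigma> \<in> H(div; \<Omega>)\<close> with weak divergence \<open>f\<close> and with normal trace \<open>\<sigma>\<nu> = t\<close> in \<open>L\<^sup>2(B)\<close> on the part
  \<open>B\<close> of the boundary, where \<open>\<nu>\<close> is the outward unit normal: again divergence and normal
  trace are the continuous extensions of the classical ones. Nothing is required of the normal
  trace on the rest of the boundary, where it need not be square integrable.
\<close>

definition Hdiv_tensor ::
  "(real^'n::finite) set \<Rightarrow> (real^'n \<Rightarrow> real^'n) \<Rightarrow> (real^'n) set \<Rightarrow>
   (real^'n \<Rightarrow> real^'n^'n) \<Rightarrow> (real^'n \<Rightarrow> real^'n) \<Rightarrow> (real^'n \<Rightarrow> real^'n) \<Rightarrow> bool" where
  "Hdiv_tensor \<Omega> \<nu> B \<sigma> f t \<longleftrightarrow>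
     (\<exists>S. (\<forall>k::nat. C1_tensor (S k)) \<and>
          l2_converges (lebesgue_on \<Omega>) S \<sigma> \<and>
          l2_converges (lebesgue_on \<Omega>) (\<lambda>k. div_tensor (S k)) f \<and>
          l2_converges (surface_measure B) (\<lambda>k x. S k x *v \<nu> x) t)"

section \<open>Stresses and energies\<close>

text \<open>
  The arguments \<open>G\<close>, \<open>Du\<close>, \<open>D\<eta>\<close> below are gradients; the quantities depend on \<open>u\<close> and \<open>\<eta>\<close>
  through them. On tensors, \<^const>\<open>norm\<close> is the Frobenius norm.
\<close>

definition sym_grad :: "real^'n^'n \<Rightarrow> real^'n^'n" where
  "sym_grad G = (1/2) *\<^sub>R (G + transpose G)"

definition stress_f :: "real \<Rightarrow> (real^'n \<Rightarrow> real^'n^'n) \<Rightarrow> (real^'n \<Rightarrow> real) \<Rightarrow> real^'n \<Rightarrow> real^'n^'n" where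
  "stress_f \<mu>f Du p x = - (p x *\<^sub>R mat 1) + (2 * \<mu>f) *\<^sub>R sym_grad (Du x)"

definition stress_s :: "real \<Rightarrow> real \<Rightarrow> (real^'n \<Rightarrow> real^'n^'n) \<Rightarrow> real^'n \<Rightarrow> real^'n^'n" where
  "stress_s \<mu>s lam_s D\<eta> x = (2 * \<mu>s) *\<^sub>R sym_grad (D\<eta> x) + (lam_s * trace (D\<eta> x)) *\<^sub>R mat 1"

definition elastic_norm_sq :: "(real^'n::finite) set \<Rightarrow> real \<Rightarrow> real \<Rightarrow> (real^'n \<Rightarrow> real^'n^'n) \<Rightarrow> real" where
  "elastic_norm_sq \<Omega>s \<mu>s lam_s D\<eta> =
     2 * \<mu>s * (l2norm (lebesgue_on \<Omega>s) (\<lambda>x. sym_grad (D\<eta> x)))\<^sup>2 +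
     lam_s * (l2norm (lebesgue_on \<Omega>s) (\<lambda>x. trace (D\<eta> x)))\<^sup>2"

definition energy ::
  "(real^'n::finite) set \<Rightarrow> (real^'n) set \<Rightarrow> real \<Rightarrow> real \<Rightarrow> real \<Rightarrow> real \<Rightarrow>
   (nat \<Rightarrow> real^'n \<Rightarrow> real^'n) \<Rightarrow> (nat \<Rightarrow> real^'n \<Rightarrow> real^'n^'n) \<Rightarrow> (nat \<Rightarrow> real^'n \<Rightarrow> real^'n) \<Rightarrow> nat \<Rightarrow> real" where
  "energy \<Omega>f \<Omega>s \<rho>f \<rho>s \<mu>s lam_s u D\<eta> \<xi> n =
     \<rho>s / 2 * (l2norm (lebesgue_on \<Omega>s) (\<xi> n))\<^sup>2 +
     1 / 2 * elastic_norm_sq \<Omega>s \<mu>s lam_s (D\<eta> n) +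
     \<rho>f / 2 * (l2norm (lebesgue_on \<Omega>f) (u n))\<^sup>2"

definition dissipation ::
  "(real^'n::finite) set \<Rightarrow> (real^'n) set \<Rightarrow> real \<Rightarrow> real \<Rightarrow> real \<Rightarrow> real \<Rightarrow> real \<Rightarrow> real \<Rightarrow>
   (nat \<Rightarrow> real^'n \<Rightarrow> real^'n) \<Rightarrow> (nat \<Rightarrow> real^'n \<Rightarrow> real^'n^'n) \<Rightarrow>
   (nat \<Rightarrow> real^'n \<Rightarrow> real^'n^'n) \<Rightarrow> (nat \<Rightarrow> real^'n \<Rightarrow> real^'n) \<Rightarrow> nat \<Rightarrow> real" where
  "dissipation \<Omega>f \<Omega>s \<rho>f \<mu>f \<rho>s \<mu>s lam_s \<Delta>t u Du D\<eta> \<xi> n =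
     \<mu>f * \<Delta>t * (l2norm (lebesgue_on \<Omega>f) (\<lambda>x. sym_grad (Du n x)))\<^sup>2 +
     \<rho>s / 2 * (l2norm (lebesgue_on \<Omega>s) (\<lambda>x. \<xi> n x - \<xi> (n - 1) x))\<^sup>2 +
     1 / 2 * elastic_norm_sq \<Omega>s \<mu>s lam_s (\<lambda>x. D\<eta> n x - D\<eta> (n - 1) x) +
     \<rho>f / 2 * (l2norm (lebesgue_on \<Omega>f) (\<lambda>x. u n x - u (n - 1) x))\<^sup>2"

text \<open>Here \<open>u\<Gamma>\<close>, \<open>\<xi>\<Gamma>\<close> are boundary traces and \<open>tf\<close>, \<open>ts\<close> the tractions \<open>\<sigma>\<^sub>f n\<^sub>f\<close>, \<open>\<sigma>\<^sub>s n\<^sub>s\<close>.\<close>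

definition interface_energy ::
  "(real^'n::finite) set \<Rightarrow> real \<Rightarrow> real \<Rightarrow> real \<Rightarrow>
   (nat \<Rightarrow> real^'n \<Rightarrow> real^'n) \<Rightarrow> (nat \<Rightarrow> real^'n \<Rightarrow> real^'n) \<Rightarrow>
   (nat \<Rightarrow> real^'n \<Rightarrow> real^'n) \<Rightarrow> (nat \<Rightarrow> real^'n \<Rightarrow> real^'n) \<Rightarrow> nat \<Rightarrow> real" where
  "interface_energy \<Gamma> L1 L2 \<Delta>t u\<Gamma> \<xi>\<Gamma> tf ts n =
     L1 * \<Delta>t / 2 * (l2norm (surface_measure \<Gamma>) (u\<Gamma> n))\<^sup>2 +
     L2 * \<Delta>t / 2 * (l2norm (surface_measure \<Gamma>) (\<xi>\<Gamma> n))\<^sup>2 +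
     \<Delta>t / (2 * L1) * (l2norm (surface_measure \<Gamma>) (tf n))\<^sup>2 +
     \<Delta>t / (2 * L2) * (l2norm (surface_measure \<Gamma>) (ts n))\<^sup>2"

section \<open>The time-discrete scheme\<close>

text \<open>
  One fluid step, from data \<open>u\<close> (with traces \<open>u\<Gamma>\<close>, \<open>\<xi>\<Gamma>\<close> and tractions \<open>tf\<close>, \<open>ts\<close>) to the primed
  quantities. \<open>Du'\<close> is the gradient of \<open>u'\<close>, \<open>f'\<close> the divergence of its stress. As
  \<open>ts\<close> is \<open>\<sigma>\<^sub>s n\<^sub>s\<close> and \<open>n\<^sub>f = -n\<^sub>s\<close> on \<open>\<Gamma>\<close>, the term \<open>\<sigma>\<^sub>s n\<^sub>f\<close> is \<open>-ts\<close>; likewise for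
  \<open>\<sigma>\<^sub>f n\<^sub>s\<close> in the structure step.

  On the Dirichlet part the trace vanishes, on the natural part the traction does.
\<close>

definition fluid_step ::
  "(real^'n::finite) set \<Rightarrow> (real^'n \<Rightarrow> real^'n) \<Rightarrow> (real^'n) set \<Rightarrow> (real^'n) set \<Rightarrow> (real^'n) set \<Rightarrow>
   real \<Rightarrow> real \<Rightarrow> real \<Rightarrow> real \<Rightarrow>
   (real^'n \<Rightarrow> real^'n) \<Rightarrow> (real^'n \<Rightarrow> real^'n) \<Rightarrow> (real^'n \<Rightarrow> real^'n) \<Rightarrow>
   (real^'n \<Rightarrow> real^'n) \<Rightarrow> (real^'n \<Rightarrow> real^'n) \<Rightarrow>
   (real^'n \<Rightarrow> real^'n) \<Rightarrow> (real^'n \<Rightarrow> real^'n^'n) \<Rightarrow> (real^'n \<Rightarrow> real^'n) \<Rightarrow> (real^'n \<Rightarrow> real) \<Rightarrow>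
   (real^'n \<Rightarrow> real^'n) \<Rightarrow> bool" where
  "fluid_step \<Omega>f nf \<Gamma> \<Gamma>D \<Gamma>N \<rho>f \<mu>f L1 \<Delta>t u u\<Gamma> \<xi>\<Gamma> tf ts u' Du' u\<Gamma>' p' tf' \<longleftrightarrow>
     (\<exists>f'. Hdiv_tensor \<Omega>f nf (\<Gamma> \<union> \<Gamma>N) (stress_f \<mu>f Du' p') f' tf' \<and>
           (AE x in lebesgue_on \<Omega>f. \<rho>f *\<^sub>R ((u' x - u x) /\<^sub>R \<Delta>t) - f' x = 0)) \<and>
     (AE x in lebesgue_on \<Omega>f. trace (Du' x) = 0) \<and>
     (AE x in surface_measure \<Gamma>.
        L1 *\<^sub>R u\<Gamma>' x + tf' x =
        (L1/2) *\<^sub>R u\<Gamma> x + (L1/2) *\<^sub>R \<xi>\<Gamma> x + (1/2) *\<^sub>R tf x + (1/2) *\<^sub>R (- ts x)) \<and>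
     (AE x in surface_measure \<Gamma>D. u\<Gamma>' x = 0) \<and>
     (AE x in surface_measure \<Gamma>N. tf' x = 0)"

definition structure_step ::
  "(real^'n::finite) set \<Rightarrow> (real^'n \<Rightarrow> real^'n) \<Rightarrow> (real^'n) set \<Rightarrow> (real^'n) set \<Rightarrow> (real^'n) set \<Rightarrow>
   real \<Rightarrow> real \<Rightarrow> real \<Rightarrow> real \<Rightarrow> real \<Rightarrow>
   (real^'n \<Rightarrow> real^'n) \<Rightarrow> (real^'n \<Rightarrow> real^'n) \<Rightarrow> (real^'n \<Rightarrow> real^'n) \<Rightarrow> (real^'n \<Rightarrow> real^'n) \<Rightarrow>
   (real^'n \<Rightarrow> real^'n) \<Rightarrow> (real^'n \<Rightarrow> real^'n) \<Rightarrow>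
   (real^'n \<Rightarrow> real^'n) \<Rightarrow> (real^'n \<Rightarrow> real^'n^'n) \<Rightarrow> (real^'n \<Rightarrow> real^'n) \<Rightarrow>
   (real^'n \<Rightarrow> real^'n) \<Rightarrow> (real^'n \<Rightarrow> real^'n) \<Rightarrow> (real^'n \<Rightarrow> real^'n) \<Rightarrow> bool" where
  "structure_step \<Omega>s ns \<Gamma> \<Gamma>D \<Gamma>N \<rho>s \<mu>s lam_s L2 \<Delta>t \<eta> \<xi> u\<Gamma> \<xi>\<Gamma> tf ts \<eta>' D\<eta>' \<eta>\<Gamma>' \<xi>' \<xi>\<Gamma>' ts' \<longleftrightarrow>
     (AE x in lebesgue_on \<Omega>s. \<xi>' x = (\<eta>' x - \<eta> x) /\<^sub>R \<Delta>t) \<and>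
     (\<exists>f'. Hdiv_tensor \<Omega>s ns (\<Gamma> \<union> \<Gamma>N) (stress_s \<mu>s lam_s D\<eta>') f' ts' \<and>
           (AE x in lebesgue_on \<Omega>s. \<rho>s *\<^sub>R ((\<xi>' x - \<xi> x) /\<^sub>R \<Delta>t) - f' x = 0)) \<and>
     (AE x in surface_measure \<Gamma>.
        L2 *\<^sub>R \<xi>\<Gamma>' x + ts' x =
        (L2/2) *\<^sub>R u\<Gamma> x + (L2/2) *\<^sub>R \<xi>\<Gamma> x + (1/2) *\<^sub>R (- tf x) + (1/2) *\<^sub>R ts x) \<and>
     (AE x in surface_measure \<Gamma>D. \<eta>\<Gamma>' x = 0 \<and> \<xi>\<Gamma>' x = 0) \<and>
     (AE x in surface_measure \<Gamma>N. ts' x = 0)"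

end

(*
  Testing the fluid momentum equation with u^{n+1} and the structure equation with xi^{n+1} gives,
  by Green's formula, energy identities whose right-hand side is the power of the tractions on the
  interface. For L1 = L2 the two Robin conditions and the parallelogram law bound this power by the
  decrease of the interface energy, and the estimates telescope.

  Two points need care. The normal trace of the stress is not controlled on the Dirichlet part, so
  in Green's formula the limit in the velocity is taken first, while the tensor is still C^1. And the
  gradient of xi^{n+1} is a difference quotient of gradients of eta only by uniqueness of weak
  gradients, which rests on the fundamental lemma of the calculus of variations.
*)
theory Submission
  imports Defs
begin

section \<open>Square integrable functions and continuously differentiable functions\<close>

text \<open>The weights L \<Delta>t/2 and \<Delta>t/(2L) of the interface energy are those for which
  the power of the tractions completes a square: t.u + (L/2)|u|^2 + |t|^2/(2L) = |L u + t|^2/(2L),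
  and L u + t is the Robin datum. Hence power plus new interface energy depend on old data alone;
  the resulting bound is pointwise on the interface and free of \<Delta>t, which is why no time step
  restriction arises. The gradient of \<xi> matters because the structure is tested with \<xi> while
  the elastic energy telescopes in gradients of \<eta>. \<open>H1_field\<close> describes gradients
  by approximating sequences, and different sequences might a priori yield different gradients.
  Green's formula excludes this: against a C^1 tensor that vanishes on the boundary, a weak gradient
  acts through the field alone.\<close>

lemma square_integrable_inner:
  fixes f g :: "'a \<Rightarrow> 'b::euclidean_space"
  assumes "square_integrable M f" "square_integrable M g"
  shows "integrable M (\<lambda>x. f x \<bullet> g x)"
proof (rule Bochner_Integration.integrable_bound)
  show "integrable M (\<lambda>x. (norm (f x))\<^sup>2 + (norm (g x))\<^sup>2)"
    using assms by (auto simp: square_integrable_def)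
  show "(\<lambda>x. f x \<bullet> g x) \<in> borel_measurable M"
    using assms by (auto simp: square_integrable_def)
  have "\<bar>a \<bullet> b\<bar> \<le> (norm a)\<^sup>2 + (norm b)\<^sup>2" for a b :: 'b
  proof -
    have "0 \<le> norm a * norm b" by simp
    then show ?thesis
      using Cauchy_Schwarz_ineq2[of a b] sum_squares_bound[of "norm a" "norm b"] by linarith
  qed
  then show "AE x in M. norm (f x \<bullet> g x) \<le> norm ((norm (f x))\<^sup>2 + (norm (g x))\<^sup>2)"
    by (intro AE_I2) simp
qed

lemma square_integrable_bounded_linear:
  fixes f :: "'a \<Rightarrow> 'b::euclidean_space" and T :: "'b \<Rightarrow> 'c::euclidean_space"
  assumes "bounded_linear T" "square_integrable M f"
  shows "square_integrable M (\<lambda>x. T (f x))"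
  unfolding square_integrable_def
proof
  interpret bounded_linear T by fact
  obtain K where K: "norm (T x) \<le> norm x * K" for x using bounded by blast
  have "continuous_on UNIV T" by (rule linear_continuous_on) fact
  then have meas: "T \<in> borel_measurable borel" by (rule borel_measurable_continuous_onI)
  have fm: "f \<in> borel_measurable M" using assms(2) by (auto simp: square_integrable_def)
  show m: "(\<lambda>x. T (f x)) \<in> borel_measurable M" using measurable_compose[OF fm meas] .
  show "integrable M (\<lambda>x. (norm (T (f x)))\<^sup>2)"
  proof (rule Bochner_Integration.integrable_bound)
    show "integrable M (\<lambda>x. K\<^sup>2 * (norm (f x))\<^sup>2)"
      using assms(2) by (auto simp: square_integrable_def)
    show "(\<lambda>x. (norm (T (f x)))\<^sup>2) \<in> borel_measurable M" using m by measurable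
    show "AE x in M. norm ((norm (T (f x)))\<^sup>2) \<le> norm (K\<^sup>2 * (norm (f x))\<^sup>2)"
      using power_mono[OF K norm_ge_zero] by (intro AE_I2) (simp add: power_mult_distrib mult.commute)
  qed
qed

lemma square_integrable_add:
  fixes f g :: "'a \<Rightarrow> 'b::euclidean_space"
  assumes "square_integrable M f" "square_integrable M g"
  shows "square_integrable M (\<lambda>x. f x + g x)"
proof -
  have "(norm (f x + g x))\<^sup>2 = (norm (f x))\<^sup>2 + 2 * (f x \<bullet> g x) + (norm (g x))\<^sup>2" for x
    by (simp add: power2_norm_eq_inner inner_simps inner_commute)
  then show ?thesis
    using assms square_integrable_inner[OF assms] by (auto simp: square_integrable_def)
qed

lemma square_integrable_scaleR:
  fixes f :: "'a \<Rightarrow> 'b::euclidean_space"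
  shows "square_integrable M f \<Longrightarrow> square_integrable M (\<lambda>x. c *\<^sub>R f x)"
  by (rule square_integrable_bounded_linear[OF bounded_linear_scaleR_right])

lemma square_integrable_diff:
  fixes f g :: "'a \<Rightarrow> 'b::euclidean_space"
  assumes "square_integrable M f" "square_integrable M g"
  shows "square_integrable M (\<lambda>x. f x - g x)"
  using square_integrable_add[OF assms(1) square_integrable_scaleR[OF assms(2), of "-1"]] by simp

lemma square_integrable_bounded:
  fixes f :: "'a \<Rightarrow> 'b::euclidean_space"
  assumes "finite_measure M" "f \<in> borel_measurable M" "AE x in M. norm (f x) \<le> B"
  shows "square_integrable M f"
  unfolding square_integrable_def
proof
  show "integrable M (\<lambda>x. (norm (f x))\<^sup>2)"
  proof (rule finite_measure.integrable_const_bound[OF assms(1)])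
    show "AE x in M. norm ((norm (f x))\<^sup>2) \<le> B\<^sup>2"
      using assms(3) by eventually_elim (simp add: power_mono)
    show "(\<lambda>x. (norm (f x))\<^sup>2) \<in> borel_measurable M" using assms(2) by measurable
  qed
qed fact

lemma l2norm_power2: "(l2norm M f)\<^sup>2 = (\<integral>x. f x \<bullet> f x \<partial>M)"
  unfolding l2norm_def by (simp add: power2_norm_eq_inner)

text \<open>The quadratic polynomial t \<mapsto> \<integral>|t f + g|^2 is nonnegative, so its
  discriminant is not positive.\<close>

lemma l2_Cauchy_Schwarz:
  fixes f g :: "'a \<Rightarrow> 'b::euclidean_space"
  assumes f: "square_integrable M f" and g: "square_integrable M g"
  shows "\<bar>\<integral>x. f x \<bullet> g x \<partial>M\<bar> \<le> l2norm M f * l2norm M g"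
proof -
  define a b c where "a = (\<integral>x. f x \<bullet> f x \<partial>M)" "b = (\<integral>x. f x \<bullet> g x \<partial>M)" "c = (\<integral>x. g x \<bullet> g x \<partial>M)"
  have q: "a * t\<^sup>2 + 2 * b * t + c \<ge> 0" for t
  proof -
    have "0 \<le> (\<integral>x. (t *\<^sub>R f x + g x) \<bullet> (t *\<^sub>R f x + g x) \<partial>M)"
      by (intro integral_nonneg_AE) simp
    also have "\<dots> = (\<integral>x. t\<^sup>2 * (f x \<bullet> f x) + 2 * t * (f x \<bullet> g x) + g x \<bullet> g x \<partial>M)"
      by (intro Bochner_Integration.integral_cong)
         (auto simp: inner_simps power2_eq_square inner_commute)
    also have "\<dots> = t\<^sup>2 * a + 2 * t * b + c"
      using square_integrable_inner[OF f f] square_integrable_inner[OF f g]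
        square_integrable_inner[OF g g] by (simp add: a_b_c_def)
    finally show ?thesis by (simp add: algebra_simps)
  qed
  have "(2 * b)\<^sup>2 \<le> 4 * a * c"
  proof (cases "a = 0")
    case True
    \<comment> \<open>Without quadratic term the polynomial is affine and stays nonnegative only if
      its slope is zero; the chosen t would give it the value -1.\<close>
    have "b = 0"
    proof (rule ccontr)
      assume "b \<noteq> 0"
      with q[of "- (c + 1) / (2 * b)"] True show False by (simp add: field_simps)
    qed
    with True show ?thesis by simp
  next
    case False
    have "a \<ge> 0" unfolding a_b_c_def by (intro integral_nonneg_AE) simp
    with False have "a > 0" by simp
    \<comment> \<open>The minimum is attained at t = -b/a; the factor a clears the
      denominators.\<close>
    have "0 \<le> a * (a * (- b / a)\<^sup>2 + 2 * b * (- b / a) + c)"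
      using q[of "- b / a"] \<open>a > 0\<close> by (intro mult_nonneg_nonneg) auto
    also have "\<dots> = a * c - b\<^sup>2" using False by (simp add: field_simps power2_eq_square)
    finally show ?thesis by (simp add: power2_eq_square)
  qed
  then have "b\<^sup>2 \<le> (l2norm M f * l2norm M g)\<^sup>2"
    by (simp add: power_mult_distrib l2norm_power2 a_b_c_def)
  moreover have "l2norm M f * l2norm M g \<ge> 0" by (simp add: l2norm_def)
  ultimately show ?thesis
    unfolding a_b_c_def by (metis abs_le_square_iff abs_of_nonneg)
qed

text \<open>All limits in Green's formula have this form: one factor is held fixed in L^2 while the
  other one converges.\<close>

lemma l2_converges_inner:
  fixes F :: "nat \<Rightarrow> 'a \<Rightarrow> 'b::euclidean_space"
  assumes F: "l2_converges M F f" and g: "square_integrable M g"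
  shows "(\<lambda>k. \<integral>x. F k x \<bullet> g x \<partial>M) \<longlonglongrightarrow> (\<integral>x. f x \<bullet> g x \<partial>M)"
proof -
  have sq: "square_integrable M (F k)" "square_integrable M f" for k
    using F by (auto simp: l2_converges_def)
  have lim: "(\<lambda>k. l2norm M (\<lambda>x. F k x - f x) * l2norm M g) \<longlonglongrightarrow> 0"
    using F by (intro tendsto_mult_left_zero) (simp add: l2_converges_def)
  have "\<bar>(\<integral>x. F k x \<bullet> g x \<partial>M) - (\<integral>x. f x \<bullet> g x \<partial>M)\<bar> \<le> l2norm M (\<lambda>x. F k x - f x) * l2norm M g" for k
    using l2_Cauchy_Schwarz[OF square_integrable_diff[OF sq] g, of k]
    by (simp add: inner_diff_left Bochner_Integration.integral_diff
        square_integrable_inner[OF sq(1) g] square_integrable_inner[OF sq(2) g])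
  then have "(\<lambda>k. (\<integral>x. F k x \<bullet> g x \<partial>M) - (\<integral>x. f x \<bullet> g x \<partial>M)) \<longlonglongrightarrow> 0"
    by (intro tendsto_rabs_zero_cancel[OF tendsto_sandwich[OF _ _ tendsto_const lim]]) auto
  then show ?thesis by (simp add: LIM_zero_iff)
qed

section \<open>C^1 functions with explicit gradients\<close>

text \<open>The gradient is an argument, so that sum and product rules become formulas for it. The
  rows of the Jacobian of a \<open>C1_field\<close> are such gradients.\<close>

definition C1_fn :: "(real^'n \<Rightarrow> real) \<Rightarrow> (real^'n \<Rightarrow> real^'n) \<Rightarrow> bool" where
  "C1_fn f g \<longleftrightarrow> continuous_on UNIV g \<and> (\<forall>x. (f has_derivative (\<lambda>h. g x \<bullet> h)) (at x))"

lemma C1_field_component: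
  assumes "C1_field v"
  shows "C1_fn (\<lambda>x. v x $ i) (\<lambda>x. grad v x $ i)"
  unfolding C1_fn_def
proof (intro conjI allI)
  show "continuous_on UNIV (\<lambda>x. grad v x $ i)"
    using assms by (auto simp: C1_field_def intro: continuous_intros)
  fix x
  have "(v has_derivative (\<lambda>h. grad v x *v h)) (at x)"
    using assms by (simp add: C1_field_def grad_def jacobian_works)
  from bounded_linear.has_derivative[OF bounded_linear_vec_nth this, of i]
  show "((\<lambda>x. v x $ i) has_derivative (\<lambda>h. grad v x $ i \<bullet> h)) (at x)"
    by (simp add: matrix_vector_mult_def inner_vec_def)
qed

text \<open>Fields that are built entry by entry, such as the product of a transposed tensor with a
  field or test tensors with a single entry, get their Jacobian from here.\<close>

lemma C1_field_from_components:
  fixes v :: "real^'n \<Rightarrow> real^'n"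
  assumes "\<And>i. C1_fn (\<lambda>x. v x $ i) (\<lambda>x. g x $ i)"
  shows "C1_field v" "grad v = g"
proof -
  have d: "(v has_derivative (\<lambda>h. g x *v h)) (at x)" for x
  proof -
    have "((\<lambda>y. v y \<bullet> b) has_derivative (\<lambda>h. (g x *v h) \<bullet> b)) (at x)" if B: "b \<in> Basis" for b
    proof -
      obtain i where b: "b = axis i 1" using B by (auto simp: Basis_vec_def)
      have "((\<lambda>y. v y $ i) has_derivative (\<lambda>h. g x $ i \<bullet> h)) (at x)"
        using assms by (simp add: C1_fn_def)
      then show ?thesis
        unfolding b inner_axis by (simp add: matrix_vector_mult_def inner_vec_def)
    qed
    then show ?thesis by (subst has_derivative_componentwise_within) simp
  qed
  show eq: "grad v = g"
  proof
    fix x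
    show "grad v x = g x"
      unfolding grad_def jacobian_def frechet_derivative_at[OF d, symmetric] by simp
  qed
  have "continuous_on UNIV (\<lambda>x. \<chi> i. g x $ i)"
    using assms by (intro continuous_on_vec_lambda) (auto simp: C1_fn_def)
  then show "C1_field v"
    using d eq by (auto simp: C1_field_def differentiable_def)
qed

lemma C1_fn_continuous: "C1_fn f g \<Longrightarrow> continuous_on UNIV f"
  by (auto simp: C1_fn_def intro: has_derivative_continuous_on has_derivative_at_withinI)

lemma C1_fn_const: "C1_fn (\<lambda>x. c) (\<lambda>x. 0)"
  by (simp add: C1_fn_def)

lemma C1_fn_add:
  "C1_fn f f' \<Longrightarrow> C1_fn g g' \<Longrightarrow> C1_fn (\<lambda>x. f x + g x) (\<lambda>x. f' x + g' x)"
  by (auto simp: C1_fn_def inner_add_left intro: continuous_intros has_derivative_add)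

lemma C1_fn_mult:
  assumes "C1_fn f f'" "C1_fn g g'"
  shows "C1_fn (\<lambda>x. f x * g x) (\<lambda>x. f x *\<^sub>R g' x + g x *\<^sub>R f' x)"
  unfolding C1_fn_def
proof (intro conjI allI)
  show "continuous_on UNIV (\<lambda>x. f x *\<^sub>R g' x + g x *\<^sub>R f' x)"
    using assms assms[THEN C1_fn_continuous] by (auto simp: C1_fn_def intro!: continuous_intros)
  fix x
  have "((\<lambda>x. f x * g x) has_derivative (\<lambda>h. f x * (g' x \<bullet> h) + (f' x \<bullet> h) * g x)) (at x)"
    using assms by (intro has_derivative_mult) (auto simp: C1_fn_def)
  then show "((\<lambda>x. f x * g x) has_derivative (\<lambda>h. (f x *\<^sub>R g' x + g x *\<^sub>R f' x) \<bullet> h)) (at x)"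
    by (simp add: inner_simps mult.commute)
qed

lemma C1_fn_sum:
  assumes "finite I" "\<And>i. i \<in> I \<Longrightarrow> C1_fn (f i) (g i)"
  shows "C1_fn (\<lambda>x. \<Sum>i\<in>I. f i x) (\<lambda>x. \<Sum>i\<in>I. g i x)"
  using assms by (induction I) (auto intro: C1_fn_const C1_fn_add)

lemma C1_fn_real_polynomial:
  assumes "real_polynomial_function f"
  shows "\<exists>g. C1_fn f g"
  using assms
proof (induction f)
  case (linear f)
  \<comment> \<open>The sum is the Riesz vector of the linear functional, which is its constant
    gradient.\<close>
  have "f x = (\<Sum>b\<in>Basis. f b *\<^sub>R b) \<bullet> x" for x
  proof -
    have "f x = f (\<Sum>b\<in>Basis. (x \<bullet> b) *\<^sub>R b)" by (simp add: euclidean_representation)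
    also have "\<dots> = (\<Sum>b\<in>Basis. (x \<bullet> b) * f b)"
      using linear by (simp add: linear_sum linear_scale bounded_linear.linear)
    finally show ?thesis by (simp add: inner_sum_left inner_commute[of x] mult.commute)
  qed
  then obtain v where "f = (\<lambda>x. v \<bullet> x)" by blast
  then show ?case
    using bounded_linear_imp_has_derivative[OF linear] by (auto simp: C1_fn_def intro!: exI[of _ "\<lambda>_. v"])
next
  case (const c)
  then show ?case using C1_fn_const by blast
next
  case (add f g)
  then show ?case using C1_fn_add by blast
next
  case (mult f g)
  then show ?case using C1_fn_mult by blast
qed

text \<open>The square of the positive part is C^1 because its derivative 2 max 0 t is continuous
  across the kink. For r > 0 the function is positive exactly on the open ball.\<close>

lemma C1_fn_bump:
  fixes c :: "real^'n" and r :: real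
  shows "\<exists>g. C1_fn (\<lambda>x. (max 0 (r\<^sup>2 - (norm (x - c))\<^sup>2))\<^sup>2) g"
proof -
  have sq: "((\<lambda>t::real. (max 0 t)\<^sup>2) has_real_derivative 2 * max 0 t) (at t)" for t
  proof -
    have "((\<lambda>t::real. (max 0 t)\<^sup>2) has_real_derivative 2 * max 0 t) (at t)" if "t > 0"
    proof (rule has_field_derivative_transform_within_open[where S="{0<..}"])
      show "((\<lambda>t. t\<^sup>2) has_real_derivative 2 * max 0 t) (at t)"
        using that by (auto intro!: derivative_eq_intros)
    qed (use that in auto)
    moreover have "((\<lambda>t::real. (max 0 t)\<^sup>2) has_real_derivative 2 * max 0 t) (at t)" if "t < 0"
    proof (rule has_field_derivative_transform_within_open[where S="{..<0}"])
      show "((\<lambda>t. 0) has_real_derivative 2 * max 0 t) (at t)"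
        using that by auto
    qed (use that in auto)
    \<comment> \<open>At the kink the difference quotient is at most |h| in modulus; elsewhere the
      function agrees locally with t^2 or with 0.\<close>
    moreover have "((\<lambda>t::real. (max 0 t)\<^sup>2) has_real_derivative 0) (at 0)"
    proof -
      have "(\<lambda>h::real. (max 0 h)\<^sup>2 / h) \<midarrow>0\<rightarrow> 0"
      proof (rule tendsto_rabs_zero_cancel, rule tendsto_sandwich[of "\<lambda>h. 0" _ _ abs])
        show "\<forall>\<^sub>F h::real in at 0. \<bar>(max 0 h)\<^sup>2 / h\<bar> \<le> \<bar>h\<bar>"
          by (intro always_eventually) (auto simp: max_def power2_eq_square field_simps)
        show "abs \<midarrow>0\<rightarrow> (0::real)" by (rule tendsto_rabs_zero[OF tendsto_ident_at])
      qed auto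
      then show ?thesis by (simp add: DERIV_def)
    qed
    ultimately show ?thesis by (cases t "0::real" rule: linorder_cases) auto
  qed
  define f where "f = (\<lambda>x::real^'n. r\<^sup>2 - (norm (x - c))\<^sup>2)"
  have df: "(f has_derivative (\<lambda>h. (- 2 *\<^sub>R (x - c)) \<bullet> h)) (at x)" for x
    unfolding f_def power2_norm_eq_inner
    by (auto intro!: derivative_eq_intros simp: inner_commute)
  have "((\<lambda>x. (max 0 (f x))\<^sup>2) has_derivative (\<lambda>h. (2 * max 0 (f x)) *\<^sub>R (- 2 *\<^sub>R (x - c)) \<bullet> h)) (at x)" for x
  proof -
    have "((\<lambda>x. (max 0 (f x))\<^sup>2) has_derivative (\<lambda>h. 2 * max 0 (f x) * ((- 2 *\<^sub>R (x - c)) \<bullet> h))) (at x)"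
      using has_derivative_compose[OF df sq[unfolded has_field_derivative_def]] by simp
    then show ?thesis by (simp only: inner_scaleR_left mult.assoc)
  qed
  moreover have "continuous_on UNIV (\<lambda>x. (2 * max 0 (f x)) *\<^sub>R (- 2 *\<^sub>R (x - c)))"
    unfolding f_def by (intro continuous_intros)
  ultimately have "C1_fn (\<lambda>x. (max 0 (f x))\<^sup>2) (\<lambda>x. (2 * max 0 (f x)) *\<^sub>R (- 2 *\<^sub>R (x - c)))"
    by (auto simp: C1_fn_def)
  then show ?thesis unfolding f_def by blast
qed

section \<open>Green's formula\<close>

lemma sets_hausdorff_measure [simp]: "sets (hausdorff_measure s) = sets borel"
  unfolding hausdorff_measure_def
  using sets.sigma_sets_eq[of borel] by (simp add: sets_measure_of)

lemma space_hausdorff_measure [simp]: "space (hausdorff_measure s) = UNIV"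
  by (simp add: hausdorff_measure_def space_measure_of_conv)

lemma borel_measurable_surface_measure:
  "f \<in> borel_measurable borel \<Longrightarrow> f \<in> borel_measurable (surface_measure B)"
  unfolding surface_measure_def
  by (rule measurable_restrict_space1) (simp add: measurable_cong_sets[OF sets_hausdorff_measure refl])

lemma AE_surface_measure:
  fixes B :: "(real^'n) set"
  assumes "B \<in> sets borel"
  shows "(AE x in surface_measure B. P x) \<longleftrightarrow> (AE x in hausdorff_measure (CARD('n) - 1). x \<in> B \<longrightarrow> P x)"
  unfolding surface_measure_def by (rule AE_restrict_space_iff) (use assms in simp)

lemma surface_measure_restrict:
  assumes "A \<in> sets borel" "B \<in> sets borel" "A \<subseteq> B"
  shows "surface_measure A = restrict_space (surface_measure B) A"
  using assms by (simp add: surface_measure_def restrict_restrict_space Int_absorb1)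

lemma square_integrable_restrict:
  fixes f :: "'a \<Rightarrow> 'b::euclidean_space"
  assumes "A \<in> sets M" "square_integrable M f"
  shows "square_integrable (restrict_space M A) f"
  using assms integrable_mult_indicator[of A M "\<lambda>x. (norm (f x))\<^sup>2"] unfolding square_integrable_def
  by (simp add: integrable_restrict_space measurable_restrict_space1)

lemma square_integrable_surface_mono:
  fixes f :: "_ \<Rightarrow> 'b::euclidean_space"
  assumes "A \<in> sets borel" "B \<in> sets borel" "A \<subseteq> B" "square_integrable (surface_measure B) f"
  shows "square_integrable (surface_measure A) f"
  unfolding surface_measure_restrict[OF assms(1-3)]
proof (rule square_integrable_restrict[OF _ assms(4)])
  show "A \<in> sets (surface_measure B)"
    using assms(1-3) by (auto simp: surface_measure_def sets_restrict_space space_restrict_space Int_absorb2)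
qed

text \<open>This is how homogeneous boundary conditions remove the Dirichlet and the natural part
  from a boundary integral.\<close>

lemma integral_surface_mono:
  fixes f :: "_ \<Rightarrow> real"
  assumes "A \<in> sets borel" "B \<in> sets borel" "A \<subseteq> B"
    and "f \<in> borel_measurable (surface_measure B)"
    and "AE x in surface_measure B. x \<notin> A \<longrightarrow> f x = 0"
  shows "(\<integral>x. f x \<partial>surface_measure B) = (\<integral>x. f x \<partial>surface_measure A)"
proof -
  have A: "A \<inter> space (surface_measure B) \<in> sets (surface_measure B)"
    using assms(1-3) by (auto simp: surface_measure_def sets_restrict_space space_restrict_space Int_absorb2)
  have "(\<integral>x. f x \<partial>surface_measure A) = (\<integral>x. indicator A x *\<^sub>R f x \<partial>surface_measure B)"
    unfolding surface_measure_restrict[OF assms(1-3)] by (rule integral_restrict_space[OF A])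
  also have "\<dots> = (\<integral>x. f x \<partial>surface_measure B)"
  proof (rule integral_cong_AE)
    show "AE x in surface_measure B. indicator A x *\<^sub>R f x = f x"
      using assms(5) by eventually_elim (auto simp: indicator_def)
    have "indicat_real A \<in> borel_measurable (surface_measure B)"
      using assms(1) by (intro borel_measurable_surface_measure) simp
    then show "(\<lambda>x. indicator A x *\<^sub>R f x) \<in> borel_measurable (surface_measure B)"
      using assms(4) by measurable
  qed fact
  finally show ?thesis by simp
qed

lemma finite_measure_surface:
  fixes B :: "(real^'n) set"
  assumes "B \<in> sets borel" "emeasure (hausdorff_measure (CARD('n) - 1)) B < \<infinity>"
  shows "finite_measure (surface_measure B)"
  using assms
  by (intro finite_measureI) (simp add: surface_measure_def emeasure_restrict_space space_restrict_space)

lemma regular_domainD: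
  assumes "regular_domain \<Omega>"
  shows "open \<Omega>" "bounded \<Omega>" "finite_measure (lebesgue_on \<Omega>)"
    "finite_measure (surface_measure (frontier \<Omega>))"
  using assms unfolding regular_domain_def
  by (auto intro: finite_measure_lebesgue_on lmeasurable_open finite_measure_surface
      simp: borel_closed frontier_closed)

section \<open>Square integrability of continuous factors in the domain and on its boundary\<close>

lemma continuous_square_integrable_domain:
  fixes f :: "real^'n \<Rightarrow> 'b::euclidean_space"
  assumes "regular_domain \<Omega>" "continuous_on UNIV f"
  shows "square_integrable (lebesgue_on \<Omega>) f"
proof -
  note \<Omega> = regular_domainD[OF assms(1)]
  have "compact (f ` closure \<Omega>)"
    using \<Omega>(2) assms(2) by (intro compact_continuous_image) (auto intro: continuous_on_subset)
  then obtain K where K: "\<And>x. x \<in> closure \<Omega> \<Longrightarrow> norm (f x) \<le> K"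
    by (metis bounded_iff compact_imp_bounded image_eqI)
  show ?thesis
  proof (rule square_integrable_bounded[OF \<Omega>(3)])
    show "f \<in> borel_measurable (lebesgue_on \<Omega>)"
      using \<Omega>(1) assms(2) by (intro continuous_imp_measurable_on_sets_lebesgue)
        (auto intro: continuous_on_subset)
    show "AE x in lebesgue_on \<Omega>. norm (f x) \<le> K"
      using K closure_subset by (intro AE_I2) (auto simp: space_restrict_space)
  qed
qed

text \<open>A continuous tensor is bounded on the compact boundary, the normal has length one, and
  the surface measure is finite. This covers the whole boundary, including the Dirichlet part, where
  the stress itself has no such control.\<close>

lemma normal_trace_square_integrable:
  fixes S :: "real^'n \<Rightarrow> real^'n^'n"
  assumes "regular_domain \<Omega>" "outward_unit_normal \<Omega> \<nu>" "continuous_on UNIV S"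
  shows "square_integrable (surface_measure (frontier \<Omega>)) (\<lambda>x. S x *v \<nu> x)"
proof -
  let ?M = "surface_measure (frontier \<Omega>)"
  note \<Omega> = regular_domainD[OF assms(1)]
  have "compact (frontier \<Omega>)" using \<Omega>(2) by (rule compact_frontier_bounded)
  then have "compact (S ` frontier \<Omega>)"
    using assms(3) by (intro compact_continuous_image) (auto intro: continuous_on_subset)
  then obtain K where K: "\<And>x. x \<in> frontier \<Omega> \<Longrightarrow> norm (S x) \<le> K"
    by (metis bounded_iff compact_imp_bounded image_eqI)
  have comp: "(S x *v \<nu> x) $ i = S x $ i \<bullet> \<nu> x" for x i
    by (simp add: matrix_vector_mult_def inner_vec_def)
  have \<nu>: "\<nu> \<in> borel_measurable ?M" "AE x in ?M. norm (\<nu> x) = 1"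
    using assms(2) by (auto simp: outward_unit_normal_def)
  show ?thesis
  proof (rule square_integrable_bounded[OF \<Omega>(4)])
    have "(\<lambda>x. (S x *v \<nu> x) \<bullet> b) \<in> borel_measurable ?M" if "b \<in> Basis" for b
    proof -
      obtain i where b: "b = axis i 1" using \<open>b \<in> Basis\<close> by (auto simp: Basis_vec_def)
      have "continuous_on UNIV (\<lambda>x. S x $ i)" using assms(3) by (intro continuous_intros)
      then have "(\<lambda>x. S x $ i) \<in> borel_measurable ?M"
        by (intro borel_measurable_surface_measure borel_measurable_continuous_onI)
      then have "(\<lambda>x. S x $ i \<bullet> \<nu> x) \<in> borel_measurable ?M" using \<nu>(1) by measurable
      then show ?thesis by (simp add: b inner_axis comp)
    qed
    then show "(\<lambda>x. S x *v \<nu> x) \<in> borel_measurable ?M"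
      by (subst borel_measurable_euclidean_space) blast
    have "AE x in ?M. x \<in> frontier \<Omega>"
      by (intro AE_I2) (simp add: surface_measure_def space_restrict_space)
    \<comment> \<open>Each component is a row of S times a unit vector, hence at most K; summing the
      components bounds the norm.\<close>
    with \<nu>(2) show "AE x in ?M. norm (S x *v \<nu> x) \<le> (\<Sum>i\<in>(UNIV::'n set). K)"
    proof eventually_elim
      case (elim x)
      have "\<bar>(S x *v \<nu> x) $ i\<bar> \<le> K" for i
        using Cauchy_Schwarz_ineq2[of "S x $ i" "\<nu> x"] K[OF elim(2)] Finite_Cartesian_Product.norm_nth_le[of "S x" i] elim(1)
        by (simp add: comp)
      then show ?case
        by (intro order_trans[OF norm_le_l1_cart] sum_mono) auto
    qed
  qed
qed

lemma C1_tensor_continuous: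
  assumes "C1_tensor S"
  shows "continuous_on UNIV S" "continuous_on UNIV (div_tensor S)"
proof -
  have row: "C1_field (\<lambda>x. S x $ i)" for i using assms by (simp add: C1_tensor_def)
  have "continuous_on UNIV (\<lambda>x. \<chi> i j. S x $ i $ j)"
    using C1_field_component[OF row, THEN C1_fn_continuous] by (intro continuous_on_vec_lambda)
  then show "continuous_on UNIV S" by simp
  have "continuous_on UNIV (\<lambda>x. trace (grad (\<lambda>y. S y $ i) x))" for i
    using row[of i] unfolding trace_def C1_field_def by (intro continuous_intros) auto
  then have "continuous_on UNIV (\<lambda>x. \<chi> i. trace (grad (\<lambda>y. S y $ i) x))"
    by (intro continuous_on_vec_lambda)
  then show "continuous_on UNIV (div_tensor S)" by (simp add: div_tensor_def[abs_def])
qed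

text \<open>The divergence theorem for the field \<open>S\<^sup>T\<phi>\<close>.\<close>

lemma Green_C1:
  fixes S :: "real^'n \<Rightarrow> real^'n^'n"
  assumes "outward_unit_normal \<Omega> \<nu>" "C1_tensor S" "C1_field \<phi>"
  shows "(\<integral>x. S x \<bullet> grad \<phi> x + div_tensor S x \<bullet> \<phi> x \<partial>lebesgue_on \<Omega>)
       = (\<integral>x. (S x *v \<nu> x) \<bullet> \<phi> x \<partial>surface_measure (frontier \<Omega>))"
proof -
  define w where "w = (\<lambda>x. \<chi> j. \<Sum>i\<in>UNIV. S x $ i $ j * \<phi> x $ i)"
  \<comment> \<open>Row j of W is the gradient of component j of w by the product rule, so its trace
    splits into the two integrands on the left-hand side.\<close>
  define W where "W = (\<lambda>x. \<chi> j. \<Sum>i\<in>UNIV. (S x $ i $ j) *\<^sub>R (grad \<phi> x $ i) + (\<phi> x $ i) *\<^sub>R (grad (\<lambda>y. S y $ i) x $ j))"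
  have row: "C1_field (\<lambda>x. S x $ i)" for i using assms by (simp add: C1_tensor_def)
  have "C1_fn (\<lambda>x. w x $ j) (\<lambda>x. W x $ j)" for j
    unfolding w_def W_def vec_lambda_beta
    using C1_fn_mult[OF C1_field_component[OF row] C1_field_component[OF assms(3)]]
    by (intro C1_fn_sum) auto
  from C1_field_from_components[OF this] have w: "C1_field w" "grad w = W" .
  have "trace (W x) = S x \<bullet> grad \<phi> x + div_tensor S x \<bullet> \<phi> x" for x
  proof -
    have "trace (W x) = (\<Sum>j\<in>UNIV. \<Sum>i\<in>UNIV. S x $ i $ j * grad \<phi> x $ i $ j)
        + (\<Sum>j\<in>UNIV. \<Sum>i\<in>UNIV. \<phi> x $ i * grad (\<lambda>y. S y $ i) x $ j $ j)"
      by (simp add: trace_def W_def sum.distrib sum_component)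
    also have "(\<Sum>j\<in>UNIV. \<Sum>i\<in>UNIV. S x $ i $ j * grad \<phi> x $ i $ j) = S x \<bullet> grad \<phi> x"
      by (subst sum.swap) (simp add: inner_vec_def)
    also have "(\<Sum>j\<in>UNIV. \<Sum>i\<in>UNIV. \<phi> x $ i * grad (\<lambda>y. S y $ i) x $ j $ j) = div_tensor S x \<bullet> \<phi> x"
      by (subst sum.swap) (simp add: inner_vec_def div_tensor_def trace_def sum_distrib_left mult.commute)
    finally show ?thesis .
  qed
  moreover have "w x \<bullet> \<nu> x = (S x *v \<nu> x) \<bullet> \<phi> x" for x
    unfolding w_def inner_vec_def matrix_vector_mult_def
    by (simp add: sum_distrib_left sum_distrib_right mult_ac) (rule sum.swap)
  ultimately show ?thesis
    using assms(1) w unfolding outward_unit_normal_def by auto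
qed

text \<open>With S fixed and C^1, its values, its divergence and its normal trace on the entire
  boundary are all square integrable, so each of the three integrals passes to the limit in the
  field.\<close>

lemma Green_H1:
  assumes \<Omega>: "regular_domain \<Omega>" and \<nu>: "outward_unit_normal \<Omega> \<nu>"
    and S: "C1_tensor S" and v: "H1_field \<Omega> v G g"
  shows "(\<integral>x. S x \<bullet> G x \<partial>lebesgue_on \<Omega>) + (\<integral>x. div_tensor S x \<bullet> v x \<partial>lebesgue_on \<Omega>)
       = (\<integral>x. (S x *v \<nu> x) \<bullet> g x \<partial>surface_measure (frontier \<Omega>))"
proof -
  let ?L = "lebesgue_on \<Omega>" and ?M = "surface_measure (frontier \<Omega>)"
  obtain \<phi> where \<phi>: "\<And>k. C1_field (\<phi> k)" "l2_converges ?L \<phi> v"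
      "l2_converges ?L (\<lambda>k. grad (\<phi> k)) G" "l2_converges ?M \<phi> g"
    using v unfolding H1_field_def by blast
  note sqS = continuous_square_integrable_domain[OF \<Omega> C1_tensor_continuous(1)[OF S]]
  note sqdiv = continuous_square_integrable_domain[OF \<Omega> C1_tensor_continuous(2)[OF S]]
  note sq\<nu> = normal_trace_square_integrable[OF \<Omega> \<nu> C1_tensor_continuous(1)[OF S]]
  have "(\<lambda>k. (\<integral>x. grad (\<phi> k) x \<bullet> S x \<partial>?L) + (\<integral>x. \<phi> k x \<bullet> div_tensor S x \<partial>?L))
      \<longlonglongrightarrow> (\<integral>x. G x \<bullet> S x \<partial>?L) + (\<integral>x. v x \<bullet> div_tensor S x \<partial>?L)"
    by (intro tendsto_add l2_converges_inner \<phi> sqS sqdiv)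
  moreover have "(\<integral>x. grad (\<phi> k) x \<bullet> S x \<partial>?L) + (\<integral>x. \<phi> k x \<bullet> div_tensor S x \<partial>?L)
      = (\<integral>x. \<phi> k x \<bullet> (S x *v \<nu> x) \<partial>?M)" for k
  proof -
    have "square_integrable ?L (\<phi> k)" "square_integrable ?L (grad (\<phi> k))"
      using \<phi> by (auto simp: l2_converges_def)
    then show ?thesis
      using Green_C1[OF \<nu> S \<phi>(1), of k]
      by (simp add: square_integrable_inner sqS sqdiv Bochner_Integration.integral_add inner_commute)
  qed
  ultimately have "(\<lambda>k. \<integral>x. \<phi> k x \<bullet> (S x *v \<nu> x) \<partial>?M)
      \<longlonglongrightarrow> (\<integral>x. G x \<bullet> S x \<partial>?L) + (\<integral>x. v x \<bullet> div_tensor S x \<partial>?L)" by simp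
  with l2_converges_inner[OF \<phi>(4) sq\<nu>] show ?thesis
    by (simp add: LIMSEQ_unique inner_commute)
qed

text \<open>As g vanishes off B, the boundary integral of each C^1 approximation is reduced to B
  before the limit in the tensor, and \<open>Hdiv_tensor\<close> provides convergence of the normal
  traces on B.\<close>

lemma Green_H1_Hdiv:
  assumes \<Omega>: "regular_domain \<Omega>" and \<nu>: "outward_unit_normal \<Omega> \<nu>"
    and v: "H1_field \<Omega> v G g" and \<sigma>: "Hdiv_tensor \<Omega> \<nu> B \<sigma> f t"
    and B: "B \<in> sets borel" "B \<subseteq> frontier \<Omega>"
    and g0: "AE x in surface_measure (frontier \<Omega>). x \<notin> B \<longrightarrow> g x = 0"
  shows "(\<integral>x. \<sigma> x \<bullet> G x \<partial>lebesgue_on \<Omega>) + (\<integral>x. f x \<bullet> v x \<partial>lebesgue_on \<Omega>)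
       = (\<integral>x. t x \<bullet> g x \<partial>surface_measure B)"
proof -
  let ?L = "lebesgue_on \<Omega>" and ?M = "surface_measure (frontier \<Omega>)"
  have fr: "frontier \<Omega> \<in> sets borel" by (simp add: borel_closed)
  obtain S where S: "\<And>k. C1_tensor (S k)" "l2_converges ?L S \<sigma>"
      "l2_converges ?L (\<lambda>k. div_tensor (S k)) f" "l2_converges (surface_measure B) (\<lambda>k x. S k x *v \<nu> x) t"
    using \<sigma> unfolding Hdiv_tensor_def by blast
  have sq: "square_integrable ?L v" "square_integrable ?L G" "square_integrable ?M g"
    using v by (auto simp: H1_field_def l2_converges_def)
  have "(\<lambda>k. (\<integral>x. S k x \<bullet> G x \<partial>?L) + (\<integral>x. div_tensor (S k) x \<bullet> v x \<partial>?L))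
      \<longlonglongrightarrow> (\<integral>x. \<sigma> x \<bullet> G x \<partial>?L) + (\<integral>x. f x \<bullet> v x \<partial>?L)"
    by (intro tendsto_add l2_converges_inner S sq)
  moreover have "(\<integral>x. S k x \<bullet> G x \<partial>?L) + (\<integral>x. div_tensor (S k) x \<bullet> v x \<partial>?L)
      = (\<integral>x. (S k x *v \<nu> x) \<bullet> g x \<partial>surface_measure B)" for k
  proof -
    note sq\<nu> = normal_trace_square_integrable[OF \<Omega> \<nu> C1_tensor_continuous(1)[OF S(1)], of k]
    have "(\<integral>x. (S k x *v \<nu> x) \<bullet> g x \<partial>?M) = (\<integral>x. (S k x *v \<nu> x) \<bullet> g x \<partial>surface_measure B)"
    proof (rule integral_surface_mono[OF B(1) fr B(2)])
      show "(\<lambda>x. (S k x *v \<nu> x) \<bullet> g x) \<in> borel_measurable ?M"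
        by (rule borel_measurable_integrable[OF square_integrable_inner[OF sq\<nu> sq(3)]])
      show "AE x in ?M. x \<notin> B \<longrightarrow> (S k x *v \<nu> x) \<bullet> g x = 0"
        using g0 by eventually_elim simp
    qed
    then show ?thesis using Green_H1[OF \<Omega> \<nu> S(1) v] by simp
  qed
  ultimately have "(\<lambda>k. \<integral>x. (S k x *v \<nu> x) \<bullet> g x \<partial>surface_measure B)
      \<longlonglongrightarrow> (\<integral>x. \<sigma> x \<bullet> G x \<partial>?L) + (\<integral>x. f x \<bullet> v x \<partial>?L)" by simp
  with l2_converges_inner[OF S(4) square_integrable_surface_mono[OF B(1) fr B(2) sq(3)]]
  show ?thesis by (simp add: LIMSEQ_unique)
qed

section \<open>Uniqueness of weak gradients\<close>

text \<open>By Stone-Weierstrass g is uniformly close to a polynomial on the compact closure of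
  \<Omega>; an error e in g changes the integral by at most e \<integral>|k|.\<close>

lemma integral_mult_eq_0_if_polynomials:
  fixes k :: "'a::euclidean_space \<Rightarrow> real"
  assumes \<Omega>: "open \<Omega>" "bounded \<Omega>" and k: "integrable (lebesgue_on \<Omega>) k"
    and poly: "\<And>P. real_polynomial_function P \<Longrightarrow> (\<integral>x. P x * k x \<partial>lebesgue_on \<Omega>) = 0"
    and g: "continuous_on UNIV g"
  shows "(\<integral>x. g x * k x \<partial>lebesgue_on \<Omega>) = 0"
proof -
  let ?L = "lebesgue_on \<Omega>"
  have int: "integrable ?L (\<lambda>x. f x * k x)" if f: "continuous_on UNIV f" for f :: "'a \<Rightarrow> real"
  proof -
    have "compact (f ` closure \<Omega>)"
      using \<Omega> f by (intro compact_continuous_image) (auto intro: continuous_on_subset)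
    then obtain K where K: "\<And>x. x \<in> closure \<Omega> \<Longrightarrow> \<bar>f x\<bar> \<le> K"
      by (metis bounded_iff compact_imp_bounded image_eqI real_norm_def)
    have [measurable]: "f \<in> borel_measurable ?L" "k \<in> borel_measurable ?L"
      using \<Omega> f k by (auto intro!: continuous_imp_measurable_on_sets_lebesgue continuous_on_subset[OF f])
    show ?thesis
    proof (rule Bochner_Integration.integrable_bound)
      show "integrable ?L (\<lambda>x. K * k x)" using k by simp
      show "(\<lambda>x. f x * k x) \<in> borel_measurable ?L" by measurable
      show "AE x in ?L. norm (f x * k x) \<le> norm (K * k x)"
      proof (rule AE_I2)
        fix x assume "x \<in> space ?L"
        then have "\<bar>f x\<bar> \<le> \<bar>K\<bar>"
          using K[of x] closure_subset[of \<Omega>] by (auto simp: space_restrict_space)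
        then show "norm (f x * k x) \<le> norm (K * k x)"
          by (simp add: abs_mult mult_right_mono)
      qed
    qed
  qed
  have "\<bar>\<integral>x. g x * k x \<partial>?L\<bar> \<le> e * (\<integral>x. \<bar>k x\<bar> \<partial>?L)" if e: "e > 0" for e
  proof -
    have "compact (closure \<Omega>)" "continuous_on (closure \<Omega>) g"
      using \<Omega> g by (auto intro: continuous_on_subset)
    then obtain P where P: "real_polynomial_function P" "\<And>x. x \<in> closure \<Omega> \<Longrightarrow> \<bar>g x - P x\<bar> < e"
      using Stone_Weierstrass_real_polynomial_function e by blast
    have Pc: "continuous_on UNIV P"
      using P(1) by (simp add: continuous_on_polymonial_function real_polynomial_function_eq)
    have "\<bar>\<integral>x. g x * k x \<partial>?L\<bar> = \<bar>\<integral>x. g x * k x - P x * k x \<partial>?L\<bar>"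
      using poly[OF P(1)] by (simp add: Bochner_Integration.integral_diff int g Pc)
    also have "\<dots> \<le> (\<integral>x. e * \<bar>k x\<bar> \<partial>?L)"
    proof (rule integral_abs_bound_integral)
      show "integrable ?L (\<lambda>x. g x * k x - P x * k x)" by (simp add: int g Pc)
      show "integrable ?L (\<lambda>x. e * \<bar>k x\<bar>)" using k by simp
      fix x assume "x \<in> space ?L"
      then have "\<bar>g x - P x\<bar> \<le> e"
        using P(2)[of x] closure_subset[of \<Omega>] by (auto simp: space_restrict_space)
      then show "\<bar>g x * k x - P x * k x\<bar> \<le> e * \<bar>k x\<bar>"
        by (simp add: abs_mult mult_right_mono flip: left_diff_distrib)
    qed
    finally show ?thesis by simp
  qed
  note * = this
  have "\<bar>\<integral>x. g x * k x \<partial>?L\<bar> \<le> 0"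
  proof (rule field_le_epsilon)
    fix e :: real assume "e > 0"
    define I where "I = (\<integral>x. \<bar>k x\<bar> \<partial>?L)"
    have "I \<ge> 0" unfolding I_def by simp
    \<comment> \<open>Division by I + 1 instead of I covers the case I = 0.\<close>
    then have "e / (I + 1) * I \<le> e"
      using \<open>e > 0\<close> by (simp add: field_simps)
    with *[of "e / (I + 1)"] \<open>e > 0\<close> \<open>I \<ge> 0\<close> show "\<bar>\<integral>x. g x * k x \<partial>?L\<bar> \<le> 0 + e"
      by (simp add: I_def[symmetric])
  qed
  then show ?thesis by simp
qed

text \<open>Testing with continuous approximations of the sign of k gives \<integral>|k| = 0 in the
  limit.\<close>

lemma AE_eq_0_if_polynomials:
  fixes k :: "'a::euclidean_space \<Rightarrow> real"
  assumes \<Omega>: "open \<Omega>" "bounded \<Omega>" and k: "integrable (lebesgue_on \<Omega>) k"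
    and poly: "\<And>P. real_polynomial_function P \<Longrightarrow> (\<integral>x. P x * k x \<partial>lebesgue_on \<Omega>) = 0"
  shows "AE x in lebesgue_on \<Omega>. k x = 0"
proof -
  let ?L = "lebesgue_on \<Omega>"
  have \<Omega>l: "\<Omega> \<in> sets lebesgue" using \<Omega> by simp
  have km[measurable]: "k \<in> borel_measurable ?L" using k by auto
  \<comment> \<open>\<open>measurable_on\<close> supplies continuous functions on the whole space
    that converge off a negligible set.\<close>
  have "(\<lambda>x. sgn (k x)) measurable_on \<Omega>"
    by (subst measurable_on_iff_borel_measurable[OF \<Omega>l]) measurable
  then obtain N g where N: "negligible N" and g: "\<And>n::nat. continuous_on UNIV (g n)"
      and lim: "\<And>x. x \<notin> N \<Longrightarrow> (\<lambda>n. g n x) \<longlonglongrightarrow> (if x \<in> \<Omega> then sgn (k x) else 0)"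
    unfolding measurable_on_def by metis
  \<comment> \<open>Truncation to [-1, 1] leaves the limit unchanged, since a sign lies in that
    interval, and makes |k| a dominating function.\<close>
  define h where "h = (\<lambda>n x. max (-1) (min 1 (g n x)))"
  have h: "continuous_on UNIV (h n)" for n
    unfolding h_def by (intro continuous_intros g)
  have hm[measurable]: "h n \<in> borel_measurable ?L" for n
    using \<Omega> by (intro continuous_imp_measurable_on_sets_lebesgue continuous_on_subset[OF h]) auto
  have "(\<lambda>n. \<integral>x. h n x * k x \<partial>?L) \<longlonglongrightarrow> (\<integral>x. \<bar>k x\<bar> \<partial>?L)"
  proof (rule integral_dominated_convergence)
    show "integrable ?L (\<lambda>x. \<bar>k x\<bar>)" using k by simp
    have "N \<in> null_sets lebesgue" using N by (simp add: negligible_iff_null_sets)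
    then have "AE x in lebesgue. x \<notin> N" by (rule AE_not_in)
    then have "AE x in ?L. x \<notin> N" using \<Omega>l by (subst AE_restrict_space_iff) auto
    moreover have "AE x in ?L. x \<in> \<Omega>" by (intro AE_I2) (simp add: space_restrict_space)
    ultimately show "AE x in ?L. (\<lambda>n. h n x * k x) \<longlonglongrightarrow> \<bar>k x\<bar>"
    proof eventually_elim
      case (elim x)
      have "(\<lambda>n. h n x) \<longlonglongrightarrow> max (-1) (min 1 (sgn (k x)))"
        unfolding h_def using lim[OF elim(1)] elim(2) by (intro tendsto_intros) simp
      also have "max (-1) (min 1 (sgn (k x))) = sgn (k x)" by (simp add: sgn_if)
      finally have "(\<lambda>n. h n x * k x) \<longlonglongrightarrow> sgn (k x) * k x" by (intro tendsto_intros)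
      then show ?case by (simp add: abs_sgn mult.commute)
    qed
    have "\<bar>h n x\<bar> \<le> 1" for n x by (auto simp: h_def)
    then have "\<bar>h n x\<bar> * \<bar>k x\<bar> \<le> 1 * \<bar>k x\<bar>" for n x by (intro mult_right_mono) auto
    then show "AE x in ?L. norm (h n x * k x) \<le> \<bar>k x\<bar>" for n
      by (intro AE_I2) (simp add: abs_mult)
  qed measurable
  then have "(\<integral>x. \<bar>k x\<bar> \<partial>?L) = 0"
    using integral_mult_eq_0_if_polynomials[OF \<Omega> k poly h] by (simp add: LIMSEQ_const_iff)
  then show ?thesis
    using integral_nonneg_eq_0_iff_AE[of ?L "\<lambda>x. \<bar>k x\<bar>"] k by simp
qed

text \<open>The fundamental lemma of the calculus of variations, tested with a bump function times a
  polynomial.\<close>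

lemma AE_eq_0_if_C1_test:
  fixes h :: "real^'n \<Rightarrow> real"
  assumes \<Omega>: "regular_domain \<Omega>" and h: "square_integrable (lebesgue_on \<Omega>) h"
    and test: "\<And>\<phi> \<phi>'. C1_fn \<phi> \<phi>' \<Longrightarrow> (\<And>x. x \<in> frontier \<Omega> \<Longrightarrow> \<phi> x = 0) \<Longrightarrow> (\<integral>x. \<phi> x * h x \<partial>lebesgue_on \<Omega>) = 0"
  shows "AE x in lebesgue_on \<Omega>. h x = 0"
proof -
  let ?L = "lebesgue_on \<Omega>"
  note \<Omega>' = regular_domainD(1,2)[OF \<Omega>]
  have ball: "AE x in ?L. x \<in> ball c r \<longrightarrow> h x = 0" if sub: "ball c r \<subseteq> \<Omega>" for c r
  proof -
    define q where "q = (\<lambda>x::real^'n. (max 0 (r\<^sup>2 - (norm (x - c))\<^sup>2))\<^sup>2)"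
    obtain q' where q': "C1_fn q q'" using C1_fn_bump unfolding q_def by blast
    have pos: "q x > 0" if "x \<in> ball c r" for x
    proof -
      have "(norm (x - c))\<^sup>2 < r\<^sup>2"
        using that by (intro power_strict_mono) (auto simp: dist_norm norm_minus_commute)
      then show ?thesis by (simp add: q_def)
    qed
    show ?thesis
    proof (cases "r > 0")
      case True
      have zero: "q x = 0" if "x \<in> frontier \<Omega>" for x
      proof -
        have "x \<notin> \<Omega>" using that \<Omega>'(1) by (simp add: frontier_def interior_open)
        then have "r \<le> norm (x - c)"
          using sub by (force simp: dist_norm norm_minus_commute)
        then have "r\<^sup>2 \<le> (norm (x - c))\<^sup>2" using True by (intro power_mono) auto
        then show ?thesis by (simp add: q_def)
      qed
      \<comment> \<open>The bump is absorbed into the function to be shown null, which leaves plain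
        polynomials P as test functions; P q is admissible because q vanishes on the
        boundary.\<close>
      have "AE x in ?L. q x * h x = 0"
      proof (rule AE_eq_0_if_polynomials[OF \<Omega>'])
        show "integrable ?L (\<lambda>x. q x * h x)"
          using square_integrable_inner[OF continuous_square_integrable_domain[OF \<Omega> C1_fn_continuous[OF q']] h]
          by simp
        fix P :: "real^'n \<Rightarrow> real" assume "real_polynomial_function P"
        then obtain P' where "C1_fn P P'" using C1_fn_real_polynomial by blast
        from test[OF C1_fn_mult[OF this q']] zero
        show "(\<integral>x. P x * (q x * h x) \<partial>?L) = 0" by (simp add: mult.assoc)
      qed
      then show ?thesis by eventually_elim (use pos in force)
    next
      case False
      then have "ball c r = {}" by simp
      then show ?thesis by (simp only: empty_iff) simp
    qed
  qed
  \<comment> \<open>Lindelof leaves countably many balls, so that the exceptional null sets of the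
    balls can be united.\<close>
  define F where "F = {ball c r | c r. ball c r \<subseteq> \<Omega>}"
  have "openin (top_of_set UNIV) S" if "S \<in> F" for S
    using that by (auto simp: F_def)
  then obtain F' where F': "F' \<subseteq> F" "countable F'" "\<Union>F' = \<Union>F"
    using Lindelof_openin[of F UNIV] by metis
  have cover: "\<Omega> \<subseteq> \<Union>F"
  proof
    fix x assume "x \<in> \<Omega>"
    then obtain r where "r > 0" "ball x r \<subseteq> \<Omega>" using \<Omega>'(1) open_contains_ball by blast
    then show "x \<in> \<Union>F" unfolding F_def by (intro UnionI[of "ball x r"]) auto
  qed
  have "AE x in ?L. \<forall>B\<in>F'. x \<in> B \<longrightarrow> h x = 0"
  proof (rule AE_ball_countable'[OF _ F'(2)])
    fix B assume "B \<in> F'"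
    then obtain c r where "B = ball c r" "ball c r \<subseteq> \<Omega>" using F'(1) by (auto simp: F_def)
    with ball show "AE x in ?L. x \<in> B \<longrightarrow> h x = 0" by blast
  qed
  moreover have "AE x in ?L. x \<in> \<Omega>" by (intro AE_I2) (simp add: space_restrict_space)
  ultimately show ?thesis
    by eventually_elim (use cover F'(3) in blast)
qed

lemma tensor_AE_eq_0_if_C1_test:
  fixes G :: "real^'n \<Rightarrow> real^'n^'n"
  assumes \<Omega>: "regular_domain \<Omega>" and G: "square_integrable (lebesgue_on \<Omega>) G"
    and test: "\<And>S. C1_tensor S \<Longrightarrow> (\<And>x. x \<in> frontier \<Omega> \<Longrightarrow> S x = 0) \<Longrightarrow> (\<integral>x. S x \<bullet> G x \<partial>lebesgue_on \<Omega>) = 0"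
  shows "AE x in lebesgue_on \<Omega>. G x = 0"
proof -
  have comp: "AE x in lebesgue_on \<Omega>. G x $ a $ b = 0" for a b
  proof (rule AE_eq_0_if_C1_test[OF \<Omega>])
    show "square_integrable (lebesgue_on \<Omega>) (\<lambda>x. G x $ a $ b)"
      using square_integrable_bounded_linear[OF bounded_linear_compose[OF bounded_linear_vec_nth bounded_linear_vec_nth] G] .
    fix \<phi> \<phi>' assume \<phi>: "C1_fn \<phi> \<phi>'" and zero: "\<And>x. x \<in> frontier \<Omega> \<Longrightarrow> \<phi> x = 0"
    \<comment> \<open>The tensor with the single nonzero entry \<phi> at (a, b) picks out that entry
      of G.\<close>
    define S :: "real^'n \<Rightarrow> real^'n^'n" where "S = (\<lambda>x. axis a (axis b (\<phi> x)))"
    have "C1_fn (\<lambda>x. S x $ i $ j) (\<lambda>x. (\<chi> j. if i = a \<and> j = b then \<phi>' x else 0) $ j)" for i j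
      using \<phi> C1_fn_const[of 0] by (cases "i = a"; cases "j = b") (auto simp: S_def axis_def)
    from C1_field_from_components(1)[OF this] have "C1_tensor S" by (simp add: C1_tensor_def)
    moreover have "S x \<bullet> G x = \<phi> x * G x $ a $ b" for x
      by (simp add: S_def inner_axis')
    ultimately show "(\<integral>x. \<phi> x * G x $ a $ b \<partial>lebesgue_on \<Omega>) = 0"
      using test[of S] zero by (simp add: S_def axis_eq_0_iff)
  qed
  have "AE x in lebesgue_on \<Omega>. \<forall>a\<in>UNIV. \<forall>b\<in>UNIV. G x $ a $ b = 0"
    by (intro AE_finite_allI comp) auto
  then show ?thesis by eventually_elim (simp add: vec_eq_iff)
qed

text \<open>The quotient of approximations of w and z approximates v as well, but it need not be the
  sequence behind Gv. Instead, both gradients are compared through their integrals against C^1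
  tensors that vanish on the boundary, which are linear in the field.\<close>

lemma H1_gradient_diff_quotient:
  assumes \<Omega>: "regular_domain \<Omega>"
    and v: "H1_field \<Omega> v Gv gv" and w: "H1_field \<Omega> w Gw gw" and z: "H1_field \<Omega> z Gz gz"
    and eq: "AE x in lebesgue_on \<Omega>. v x = (w x - z x) /\<^sub>R c"
  shows "AE x in lebesgue_on \<Omega>. Gv x = (Gw x - Gz x) /\<^sub>R c"
proof -
  let ?L = "lebesgue_on \<Omega>"
  obtain \<nu> where \<nu>: "outward_unit_normal \<Omega> \<nu>" using \<Omega> by (auto simp: regular_domain_def)
  have sq: "square_integrable ?L v" "square_integrable ?L w" "square_integrable ?L z"
     "square_integrable ?L Gv" "square_integrable ?L Gw" "square_integrable ?L Gz"
    using v w z by (auto simp: H1_field_def l2_converges_def)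
  have "AE x in ?L. Gv x - (Gw x - Gz x) /\<^sub>R c = 0"
  proof (rule tensor_AE_eq_0_if_C1_test[OF \<Omega>])
    show "square_integrable ?L (\<lambda>x. Gv x - (Gw x - Gz x) /\<^sub>R c)"
      by (intro square_integrable_diff square_integrable_scaleR sq)
    fix S assume S: "C1_tensor S" and S0: "\<And>x. x \<in> frontier \<Omega> \<Longrightarrow> S x = 0"
    note sqS = continuous_square_integrable_domain[OF \<Omega> C1_tensor_continuous(1)[OF S]]
    note sqdiv = continuous_square_integrable_domain[OF \<Omega> C1_tensor_continuous(2)[OF S]]
    \<comment> \<open>The boundary term vanishes with S, so the right-hand side involves only
      u.\<close>
    have G: "(\<integral>x. S x \<bullet> H x \<partial>?L) = - (\<integral>x. div_tensor S x \<bullet> u x \<partial>?L)" if "H1_field \<Omega> u H g" for u H g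
    proof -
      have "(\<integral>x. (S x *v \<nu> x) \<bullet> g x \<partial>surface_measure (frontier \<Omega>)) = (\<integral>x. 0 \<partial>surface_measure (frontier \<Omega>))"
        by (intro Bochner_Integration.integral_cong)
           (auto simp: S0 surface_measure_def space_restrict_space)
      then show ?thesis using Green_H1[OF \<Omega> \<nu> S that] by simp
    qed
    have "(\<integral>x. div_tensor S x \<bullet> v x \<partial>?L)
        = (\<integral>x. (div_tensor S x \<bullet> w x - div_tensor S x \<bullet> z x) / c \<partial>?L)"
    proof (rule integral_cong_AE)
      show "AE x in ?L. div_tensor S x \<bullet> v x = (div_tensor S x \<bullet> w x - div_tensor S x \<bullet> z x) / c"
        using eq by eventually_elim (simp add: inner_diff_right divide_inverse mult.commute)
    qed (use sq sqdiv in \<open>auto intro!: borel_measurable_integrable square_integrable_inner\<close>)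
    also have "\<dots> = ((\<integral>x. div_tensor S x \<bullet> w x \<partial>?L) - (\<integral>x. div_tensor S x \<bullet> z x \<partial>?L)) / c"
      by (simp add: Bochner_Integration.integral_diff square_integrable_inner sqdiv sq)
    finally have 1: "(\<integral>x. div_tensor S x \<bullet> v x \<partial>?L)
       = ((\<integral>x. div_tensor S x \<bullet> w x \<partial>?L) - (\<integral>x. div_tensor S x \<bullet> z x \<partial>?L)) / c" .
    have "(\<integral>x. S x \<bullet> (Gv x - (Gw x - Gz x) /\<^sub>R c) \<partial>?L)
        = (\<integral>x. S x \<bullet> Gv x - (S x \<bullet> Gw x - S x \<bullet> Gz x) / c \<partial>?L)"
      by (simp add: inner_diff_right divide_inverse mult.commute)
    also have "\<dots> = (\<integral>x. S x \<bullet> Gv x \<partial>?L) - ((\<integral>x. S x \<bullet> Gw x \<partial>?L) - (\<integral>x. S x \<bullet> Gz x \<partial>?L)) / c"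
      by (simp add: Bochner_Integration.integral_diff square_integrable_inner sqS sq)
    also have "\<dots> = 0" unfolding G[OF v] G[OF w] G[OF z] 1 by (simp add: field_simps diff_divide_distrib)
    finally show "(\<integral>x. S x \<bullet> (Gv x - (Gw x - Gz x) /\<^sub>R c) \<partial>?L) = 0" .
  qed
  then show ?thesis by eventually_elim simp
qed

section \<open>Energy balance of one time step\<close>

text \<open>The two parts away from \<Gamma> drop out for different reasons: on
  \<open>\<Gamma>D\<close> the trace of the test field is zero, on \<open>\<Gamma>N\<close> the
  traction. The former goes first, because t represents the normal trace on the other two parts
  only.\<close>

lemma Green_boundary_partition:
  assumes \<Omega>: "regular_domain \<Omega>" and \<nu>: "outward_unit_normal \<Omega> \<nu>"
    and part: "boundary_partition \<Omega> \<Gamma> \<Gamma>D \<Gamma>N"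
    and v: "H1_field \<Omega> v G g" and \<sigma>: "Hdiv_tensor \<Omega> \<nu> (\<Gamma> \<union> \<Gamma>N) \<sigma> f t"
    and g0: "AE x in surface_measure \<Gamma>D. g x = 0" and t0: "AE x in surface_measure \<Gamma>N. t x = 0"
  shows "(\<integral>x. \<sigma> x \<bullet> G x \<partial>lebesgue_on \<Omega>) + (\<integral>x. f x \<bullet> v x \<partial>lebesgue_on \<Omega>)
       = (\<integral>x. t x \<bullet> g x \<partial>surface_measure \<Gamma>)"
proof -
  have b: "\<Gamma> \<in> sets borel" "\<Gamma>D \<in> sets borel" "\<Gamma>N \<in> sets borel" "\<Gamma> \<union> \<Gamma>N \<in> sets borel"
      "frontier \<Omega> \<in> sets borel"
    and fr: "frontier \<Omega> = \<Gamma> \<union> \<Gamma>D \<union> \<Gamma>N"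
    using part by (auto simp: boundary_partition_def borel_closed)
  have sub: "\<Gamma> \<union> \<Gamma>N \<subseteq> frontier \<Omega>" by (auto simp: fr)
  have "AE x in surface_measure (frontier \<Omega>). x \<notin> \<Gamma> \<union> \<Gamma>N \<longrightarrow> g x = 0"
    unfolding AE_surface_measure[OF b(5)]
    using g0[unfolded AE_surface_measure[OF b(2)]] by eventually_elim (auto simp: fr)
  note Green_H1_Hdiv[OF \<Omega> \<nu> v \<sigma> b(4) sub this]
  also have "(\<integral>x. t x \<bullet> g x \<partial>surface_measure (\<Gamma> \<union> \<Gamma>N)) = (\<integral>x. t x \<bullet> g x \<partial>surface_measure \<Gamma>)"
  proof (rule integral_surface_mono[OF b(1,4)])
    have "square_integrable (surface_measure (frontier \<Omega>)) g"
      using v by (auto simp: H1_field_def l2_converges_def)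
    from square_integrable_surface_mono[OF b(4,5) sub this]
    show "(\<lambda>x. t x \<bullet> g x) \<in> borel_measurable (surface_measure (\<Gamma> \<union> \<Gamma>N))"
      using \<sigma> unfolding Hdiv_tensor_def l2_converges_def
      by (auto intro: borel_measurable_integrable square_integrable_inner)
    show "AE x in surface_measure (\<Gamma> \<union> \<Gamma>N). x \<notin> \<Gamma> \<longrightarrow> t x \<bullet> g x = 0"
      unfolding AE_surface_measure[OF b(4)]
      using t0[unfolded AE_surface_measure[OF b(3)]] by eventually_elim auto
  qed auto
  finally show ?thesis .
qed

text \<open>The backward Euler identity: an increment tested with the new value gives a difference
  of squares, which telescopes, and a squared increment, which is numerical dissipation.\<close>

lemma inner_diff_polarization:
  "(a - b) \<bullet> a = (a \<bullet> a - b \<bullet> b + (a - b) \<bullet> (a - b)) / 2" for a b :: "'a::real_inner"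
  by (simp add: inner_simps inner_commute)

lemma integral_inner_diff:
  fixes v w :: "'a \<Rightarrow> 'b::euclidean_space"
  assumes v: "square_integrable M v" and w: "square_integrable M w"
  shows "(\<integral>x. (v x - w x) \<bullet> v x \<partial>M)
    = ((l2norm M v)\<^sup>2 - (l2norm M w)\<^sup>2 + (l2norm M (\<lambda>x. v x - w x))\<^sup>2) / 2"
proof -
  note d = square_integrable_diff[OF v w]
  have "(\<integral>x. (v x - w x) \<bullet> v x \<partial>M)
      = (\<integral>x. (v x \<bullet> v x - w x \<bullet> w x + (v x - w x) \<bullet> (v x - w x)) / 2 \<partial>M)"
    by (simp only: inner_diff_polarization[of "v _" "w _"])
  also have "\<dots> = ((l2norm M v)\<^sup>2 - (l2norm M w)\<^sup>2 + (l2norm M (\<lambda>x. v x - w x))\<^sup>2) / 2"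
    unfolding l2norm_power2
    using square_integrable_inner[OF v v] square_integrable_inner[OF w w] square_integrable_inner[OF d d]
    by simp
  finally show ?thesis .
qed

text \<open>Here f is the divergence of the stress; the lemma serves fluid and structure
  alike.\<close>

lemma momentum_kinetic_energy:
  fixes v v' f :: "'a \<Rightarrow> 'b::euclidean_space"
  assumes v: "square_integrable M v" and v': "square_integrable M v'" and f: "square_integrable M f"
    and "\<Delta>t > 0" and eq: "AE x in M. \<rho> *\<^sub>R ((v' x - v x) /\<^sub>R \<Delta>t) - f x = 0"
  shows "\<Delta>t * (\<integral>x. f x \<bullet> v' x \<partial>M)
    = \<rho> / 2 * ((l2norm M v')\<^sup>2 - (l2norm M v)\<^sup>2 + (l2norm M (\<lambda>x. v' x - v x))\<^sup>2)"
proof -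
  have "(\<integral>x. f x \<bullet> v' x \<partial>M) = (\<integral>x. \<rho> / \<Delta>t * ((v' x - v x) \<bullet> v' x) \<partial>M)"
  proof (rule integral_cong_AE)
    show "AE x in M. f x \<bullet> v' x = \<rho> / \<Delta>t * ((v' x - v x) \<bullet> v' x)"
      using eq
    proof eventually_elim
      case (elim x)
      then have "f x = (\<rho> / \<Delta>t) *\<^sub>R (v' x - v x)" by (simp add: divide_inverse)
      then show ?case by simp
    qed
    show "(\<lambda>x. f x \<bullet> v' x) \<in> borel_measurable M"
      by (intro borel_measurable_integrable square_integrable_inner f v')
    show "(\<lambda>x. \<rho> / \<Delta>t * ((v' x - v x) \<bullet> v' x)) \<in> borel_measurable M"
      by (intro borel_measurable_integrable integrable_mult_right square_integrable_inner
          square_integrable_diff v v')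
  qed
  also have "\<dots> = \<rho> / \<Delta>t * (\<integral>x. (v' x - v x) \<bullet> v' x \<partial>M)" by simp
  finally show ?thesis using \<open>\<Delta>t > 0\<close> by (simp add: integral_inner_diff[OF v' v])
qed

section \<open>Frobenius products with symmetric gradients\<close>

lemma inner_transpose: "transpose A \<bullet> B = A \<bullet> transpose B" for A :: "real^'n^'m" and B :: "real^'m^'n"
  unfolding inner_vec_def transpose_def by simp (rule sum.swap)

lemma mat_1_inner: "mat 1 \<bullet> A = trace A" for A :: "real^'n^'n"
  by (simp add: inner_vec_def mat_def trace_def if_distrib if_distribR cong: if_cong)

text \<open>A symmetric matrix is orthogonal to the skew part of B.\<close>

lemma sym_grad_inner: "sym_grad A \<bullet> B = sym_grad A \<bullet> sym_grad B"
proof -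
  have "sym_grad A \<bullet> transpose B = sym_grad A \<bullet> B"
    unfolding inner_transpose[symmetric]
    by (simp add: sym_grad_def transpose_scalar transpose_def vec_eq_iff inner_vec_def add.commute)
  then show ?thesis by (simp add: sym_grad_def[of B] inner_add_right)
qed

lemma bounded_linear_sym_grad: "bounded_linear sym_grad"
  by (intro linear_conv_bounded_linear[THEN iffD1] linearI)
     (auto simp: sym_grad_def transpose_def vec_eq_iff algebra_simps)

lemma bounded_linear_trace: "bounded_linear (trace :: real^'n^'n \<Rightarrow> real)"
  by (intro linear_conv_bounded_linear[THEN iffD1] linearI)
     (auto simp: trace_def sum.distrib sum_distrib_left)

lemma fluid_energy_identity:
  assumes \<Omega>: "regular_domain \<Omega>" and \<nu>: "outward_unit_normal \<Omega> \<nu>"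
    and part: "boundary_partition \<Omega> \<Gamma> \<Gamma>D \<Gamma>N" and "\<Delta>t > 0"
    and u: "square_integrable (lebesgue_on \<Omega>) u" and u': "H1_field \<Omega> u' Du' u\<Gamma>'"
    and step: "fluid_step \<Omega> \<nu> \<Gamma> \<Gamma>D \<Gamma>N \<rho> \<mu> L \<Delta>t u u\<Gamma> \<xi>\<Gamma> tf ts u' Du' u\<Gamma>' p' tf'"
  shows "\<rho> / 2 * ((l2norm (lebesgue_on \<Omega>) u')\<^sup>2 - (l2norm (lebesgue_on \<Omega>) u)\<^sup>2
           + (l2norm (lebesgue_on \<Omega>) (\<lambda>x. u' x - u x))\<^sup>2)
       + 2 * \<mu> * \<Delta>t * (l2norm (lebesgue_on \<Omega>) (\<lambda>x. sym_grad (Du' x)))\<^sup>2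
     = \<Delta>t * (\<integral>x. tf' x \<bullet> u\<Gamma>' x \<partial>surface_measure \<Gamma>)"
proof -
  let ?L = "lebesgue_on \<Omega>" and ?\<sigma> = "stress_f \<mu> Du' p'"
  obtain f where \<sigma>: "Hdiv_tensor \<Omega> \<nu> (\<Gamma> \<union> \<Gamma>N) ?\<sigma> f tf'"
    and mom: "AE x in ?L. \<rho> *\<^sub>R ((u' x - u x) /\<^sub>R \<Delta>t) - f x = 0"
    and div0: "AE x in ?L. trace (Du' x) = 0"
    and bc: "AE x in surface_measure \<Gamma>D. u\<Gamma>' x = 0" "AE x in surface_measure \<Gamma>N. tf' x = 0"
    using step unfolding fluid_step_def by blast
  have sq: "square_integrable ?L ?\<sigma>" "square_integrable ?L f" "square_integrable ?L u'"
      "square_integrable ?L Du'"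
    using \<sigma> u' unfolding Hdiv_tensor_def H1_field_def l2_converges_def by auto
  have "(\<integral>x. ?\<sigma> x \<bullet> Du' x \<partial>?L) = (\<integral>x. 2 * \<mu> * (sym_grad (Du' x) \<bullet> sym_grad (Du' x)) \<partial>?L)"
  proof (rule integral_cong_AE)
    \<comment> \<open>Incompressibility removes the pressure: the identity matrix paired with the
      velocity gradient is the divergence.\<close>
    show "AE x in ?L. ?\<sigma> x \<bullet> Du' x = 2 * \<mu> * (sym_grad (Du' x) \<bullet> sym_grad (Du' x))"
      using div0
    proof eventually_elim
      case (elim x)
      then show ?case
        using sym_grad_inner[of "Du' x" "Du' x"]
        by (simp add: stress_f_def inner_diff_left inner_add_left mat_1_inner)
    qed
    show "(\<lambda>x. ?\<sigma> x \<bullet> Du' x) \<in> borel_measurable ?L"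
      by (intro borel_measurable_integrable square_integrable_inner sq)
    show "(\<lambda>x. 2 * \<mu> * (sym_grad (Du' x) \<bullet> sym_grad (Du' x))) \<in> borel_measurable ?L"
      by (intro borel_measurable_integrable integrable_mult_right square_integrable_inner
          square_integrable_bounded_linear[OF bounded_linear_sym_grad] sq)
  qed
  also have "\<dots> = 2 * \<mu> * (l2norm ?L (\<lambda>x. sym_grad (Du' x)))\<^sup>2"
    by (simp add: l2norm_power2)
  finally have "2 * \<mu> * (l2norm ?L (\<lambda>x. sym_grad (Du' x)))\<^sup>2 + (\<integral>x. f x \<bullet> u' x \<partial>?L)
      = (\<integral>x. tf' x \<bullet> u\<Gamma>' x \<partial>surface_measure \<Gamma>)"
    using Green_boundary_partition[OF \<Omega> \<nu> part u' \<sigma> bc] by simp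
  then have "\<Delta>t * (2 * \<mu> * (l2norm ?L (\<lambda>x. sym_grad (Du' x)))\<^sup>2) + \<Delta>t * (\<integral>x. f x \<bullet> u' x \<partial>?L)
      = \<Delta>t * (\<integral>x. tf' x \<bullet> u\<Gamma>' x \<partial>surface_measure \<Gamma>)"
    by (simp flip: distrib_left)
  then show ?thesis
    unfolding momentum_kinetic_energy[OF u sq(3,2) \<open>\<Delta>t > 0\<close> mom] by (simp add: ac_simps)
qed

text \<open>The product of traces is written as an inner product on the reals, and the factor from B
  comes first, so that \<open>integral_inner_diff\<close> applies to both terms when B is an
  increment.\<close>

lemma stress_s_inner:
  "stress_s \<mu> l A x \<bullet> B = 2 * \<mu> * (sym_grad B \<bullet> sym_grad (A x)) + l * (trace B \<bullet> trace (A x))"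
  unfolding stress_s_def inner_add_left inner_scaleR_left mat_1_inner sym_grad_inner[of "A x" B]
  by (simp add: inner_commute)

text \<open>The elastic energy is a quadratic form, so the backward Euler identity holds for it,
  separately for symmetric gradient and trace.\<close>

lemma integral_stress_s_diff:
  assumes A: "square_integrable (lebesgue_on \<Omega>) A" and B: "square_integrable (lebesgue_on \<Omega>) B"
  shows "(\<integral>x. stress_s \<mu> l A x \<bullet> (A x - B x) \<partial>lebesgue_on \<Omega>)
    = 1 / 2 * (elastic_norm_sq \<Omega> \<mu> l A - elastic_norm_sq \<Omega> \<mu> l B
        + elastic_norm_sq \<Omega> \<mu> l (\<lambda>x. A x - B x))"
proof -
  note sym = A[THEN square_integrable_bounded_linear[OF bounded_linear_sym_grad]]
    B[THEN square_integrable_bounded_linear[OF bounded_linear_sym_grad]]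
  note tr = A[THEN square_integrable_bounded_linear[OF bounded_linear_trace]]
    B[THEN square_integrable_bounded_linear[OF bounded_linear_trace]]
  have d: "sym_grad (A x - B x) = sym_grad (A x) - sym_grad (B x)"
      "trace (A x - B x) = trace (A x) - trace (B x)" for x
    by (simp_all add: linear_diff bounded_linear.linear bounded_linear_sym_grad bounded_linear_trace)
  have "(\<integral>x. stress_s \<mu> l A x \<bullet> (A x - B x) \<partial>lebesgue_on \<Omega>)
      = 2 * \<mu> * (\<integral>x. (sym_grad (A x) - sym_grad (B x)) \<bullet> sym_grad (A x) \<partial>lebesgue_on \<Omega>)
      + l * (\<integral>x. (trace (A x) - trace (B x)) \<bullet> trace (A x) \<partial>lebesgue_on \<Omega>)"
    unfolding stress_s_inner d
    using square_integrable_inner[OF square_integrable_diff[OF sym] sym(1)]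
      square_integrable_inner[OF square_integrable_diff[OF tr] tr(1)]
    by (subst Bochner_Integration.integral_add) auto
  then show ?thesis
    unfolding integral_inner_diff[OF sym] integral_inner_diff[OF tr] elastic_norm_sq_def d
    by (simp add: field_simps)
qed

text \<open>The test field is the new velocity \<xi>'. Multiplying by \<Delta>t turns its gradient
  into the increment of displacement gradients, whose product with the stress yields the change of
  elastic energy.\<close>

lemma structure_energy_identity:
  assumes \<Omega>: "regular_domain \<Omega>" and \<nu>: "outward_unit_normal \<Omega> \<nu>"
    and part: "boundary_partition \<Omega> \<Gamma> \<Gamma>D \<Gamma>N" and "\<Delta>t > 0"
    and \<eta>: "H1_field \<Omega> \<eta> D\<eta> \<eta>\<Gamma>" and \<eta>': "H1_field \<Omega> \<eta>' D\<eta>' \<eta>\<Gamma>'"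
    and \<xi>: "square_integrable (lebesgue_on \<Omega>) \<xi>" and \<xi>': "H1_field \<Omega> \<xi>' D\<xi>' \<xi>\<Gamma>'"
    and step: "structure_step \<Omega> \<nu> \<Gamma> \<Gamma>D \<Gamma>N \<rho> \<mu> l L \<Delta>t \<eta> \<xi> u\<Gamma> \<xi>\<Gamma> tf ts \<eta>' D\<eta>' \<eta>\<Gamma>' \<xi>' \<xi>\<Gamma>' ts'"
  shows "\<rho> / 2 * ((l2norm (lebesgue_on \<Omega>) \<xi>')\<^sup>2 - (l2norm (lebesgue_on \<Omega>) \<xi>)\<^sup>2
           + (l2norm (lebesgue_on \<Omega>) (\<lambda>x. \<xi>' x - \<xi> x))\<^sup>2)
       + 1 / 2 * (elastic_norm_sq \<Omega> \<mu> l D\<eta>' - elastic_norm_sq \<Omega> \<mu> l D\<eta>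
           + elastic_norm_sq \<Omega> \<mu> l (\<lambda>x. D\<eta>' x - D\<eta> x))
     = \<Delta>t * (\<integral>x. ts' x \<bullet> \<xi>\<Gamma>' x \<partial>surface_measure \<Gamma>)"
proof -
  let ?L = "lebesgue_on \<Omega>" and ?\<sigma> = "stress_s \<mu> l D\<eta>'"
  obtain f where \<sigma>: "Hdiv_tensor \<Omega> \<nu> (\<Gamma> \<union> \<Gamma>N) ?\<sigma> f ts'"
    and mom: "AE x in ?L. \<rho> *\<^sub>R ((\<xi>' x - \<xi> x) /\<^sub>R \<Delta>t) - f x = 0"
    and vel: "AE x in ?L. \<xi>' x = (\<eta>' x - \<eta> x) /\<^sub>R \<Delta>t"
    and bcD: "AE x in surface_measure \<Gamma>D. \<eta>\<Gamma>' x = 0 \<and> \<xi>\<Gamma>' x = 0"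
    and bcN: "AE x in surface_measure \<Gamma>N. ts' x = 0"
    using step unfolding structure_step_def by blast
  have bcD': "AE x in surface_measure \<Gamma>D. \<xi>\<Gamma>' x = 0" using bcD by eventually_elim simp
  have sq: "square_integrable ?L ?\<sigma>" "square_integrable ?L f" "square_integrable ?L \<xi>'"
      "square_integrable ?L D\<xi>'" "square_integrable ?L D\<eta>'" "square_integrable ?L D\<eta>"
    using \<sigma> \<xi>' \<eta> \<eta>' unfolding Hdiv_tensor_def H1_field_def l2_converges_def by auto
  have "(\<integral>x. ?\<sigma> x \<bullet> D\<xi>' x \<partial>?L) = (\<integral>x. (?\<sigma> x \<bullet> (D\<eta>' x - D\<eta> x)) / \<Delta>t \<partial>?L)"
  proof (rule integral_cong_AE)
    show "AE x in ?L. ?\<sigma> x \<bullet> D\<xi>' x = (?\<sigma> x \<bullet> (D\<eta>' x - D\<eta> x)) / \<Delta>t"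
      using H1_gradient_diff_quotient[OF \<Omega> \<xi>' \<eta>' \<eta> vel]
      by eventually_elim (simp add: divide_inverse mult.commute)
    show "(\<lambda>x. ?\<sigma> x \<bullet> D\<xi>' x) \<in> borel_measurable ?L"
      by (intro borel_measurable_integrable square_integrable_inner sq)
    show "(\<lambda>x. (?\<sigma> x \<bullet> (D\<eta>' x - D\<eta> x)) / \<Delta>t) \<in> borel_measurable ?L"
      by (intro borel_measurable_integrable integrable_divide square_integrable_inner
          square_integrable_diff sq)
  qed
  also have "\<dots> = (\<integral>x. ?\<sigma> x \<bullet> (D\<eta>' x - D\<eta> x) \<partial>?L) / \<Delta>t" by simp
  finally have el: "\<Delta>t * (\<integral>x. ?\<sigma> x \<bullet> D\<xi>' x \<partial>?L) = (\<integral>x. ?\<sigma> x \<bullet> (D\<eta>' x - D\<eta> x) \<partial>?L)"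
    using \<open>\<Delta>t > 0\<close> by simp
  have "\<Delta>t * (\<integral>x. ?\<sigma> x \<bullet> D\<xi>' x \<partial>?L) + \<Delta>t * (\<integral>x. f x \<bullet> \<xi>' x \<partial>?L)
      = \<Delta>t * (\<integral>x. ts' x \<bullet> \<xi>\<Gamma>' x \<partial>surface_measure \<Gamma>)"
    using Green_boundary_partition[OF \<Omega> \<nu> part \<xi>' \<sigma> bcD' bcN] by (simp flip: distrib_left)
  then show ?thesis
    unfolding el integral_stress_s_diff[OF sq(5,6)]
      momentum_kinetic_energy[OF \<xi> sq(3,2) \<open>\<Delta>t > 0\<close> mom] by (simp add: ac_simps)
qed

text \<open>With \<open>P = L u' + t'\<close> one has \<open>t' \<bullet> u' + L/2 |u'|\<^sup>2 + |t'|\<^sup>2/(2L) = |P|\<^sup>2/(2L)\<close>. The Robin data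
  are \<open>(a + b)/2\<close> and \<open>(a - b)/2\<close> with \<open>a = L (u + \<xi>)\<close>, \<open>b = t - s\<close>, so the parallelogram law applies;
  this is where equal Robin parameters are needed.\<close>

lemma Robin_exchange:
  fixes u x t s u' x' t' s' :: "'a::real_inner"
  assumes "L > 0"
    and P: "L *\<^sub>R u' + t' = (L/2) *\<^sub>R u + (L/2) *\<^sub>R x + (1/2) *\<^sub>R t + (1/2) *\<^sub>R (- s)"
    and Q: "L *\<^sub>R x' + s' = (L/2) *\<^sub>R u + (L/2) *\<^sub>R x + (1/2) *\<^sub>R (- t) + (1/2) *\<^sub>R s"
  shows "t' \<bullet> u' + s' \<bullet> x'
      + (L/2 * (u' \<bullet> u') + L/2 * (x' \<bullet> x') + 1/(2*L) * (t' \<bullet> t') + 1/(2*L) * (s' \<bullet> s'))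
    \<le> L/2 * (u \<bullet> u) + L/2 * (x \<bullet> x) + 1/(2*L) * (t \<bullet> t) + 1/(2*L) * (s \<bullet> s)"
proof -
  define a b where "a = L *\<^sub>R (u + x)" and "b = t - s"
  have P': "L *\<^sub>R u' + t' = (1/2) *\<^sub>R (a + b)" and Q': "L *\<^sub>R x' + s' = (1/2) *\<^sub>R (a - b)"
    unfolding P Q by (simp_all add: a_def b_def scaleR_diff_right scaleR_add_right)
  have expand: "w \<bullet> v + L/2 * (v \<bullet> v) + 1/(2*L) * (w \<bullet> w)
      = 1/(2*L) * ((L *\<^sub>R v + w) \<bullet> (L *\<^sub>R v + w))" for v w :: 'a
    using \<open>L > 0\<close> by (simp add: inner_simps inner_commute field_simps power2_eq_square)
  have "(1/2) *\<^sub>R (a + b) \<bullet> (1/2) *\<^sub>R (a + b) + (1/2) *\<^sub>R (a - b) \<bullet> (1/2) *\<^sub>R (a - b) = (a \<bullet> a + b \<bullet> b) / 2"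
    by (simp add: inner_simps inner_commute field_simps)
  \<comment> \<open>The terms lost are multiples of |u - x|^2 and |t + s|^2, the mismatches in the
    kinematic and the dynamic coupling condition.\<close>
  also have "a \<bullet> a + b \<bullet> b \<le> 2 * (L\<^sup>2 * (u \<bullet> u + x \<bullet> x) + (t \<bullet> t + s \<bullet> s))"
  proof -
    have "(u + x) \<bullet> (u + x) \<le> 2 * (u \<bullet> u + x \<bullet> x)"
      using inner_ge_zero[of "u - x"] by (simp add: inner_simps inner_commute)
    then have "L\<^sup>2 * ((u + x) \<bullet> (u + x)) \<le> L\<^sup>2 * (2 * (u \<bullet> u + x \<bullet> x))"
      by (intro mult_left_mono) auto
    moreover have "b \<bullet> b \<le> 2 * (t \<bullet> t + s \<bullet> s)"
      using inner_ge_zero[of "t + s"] by (simp add: b_def inner_simps inner_commute)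
    moreover have "a \<bullet> a = L\<^sup>2 * ((u + x) \<bullet> (u + x))"
      by (simp add: a_def power2_eq_square)
    ultimately show ?thesis by (simp add: distrib_left)
  qed
  finally have "1/(2*L) * ((1/2) *\<^sub>R (a + b) \<bullet> (1/2) *\<^sub>R (a + b)) + 1/(2*L) * ((1/2) *\<^sub>R (a - b) \<bullet> (1/2) *\<^sub>R (a - b))
      \<le> 1/(2*L) * (L\<^sup>2 * (u \<bullet> u + x \<bullet> x) + (t \<bullet> t + s \<bullet> s))"
    using \<open>L > 0\<close> unfolding distrib_left[symmetric] by (intro mult_left_mono) auto
  also have "\<dots> = L/2 * (u \<bullet> u) + L/2 * (x \<bullet> x) + 1/(2*L) * (t \<bullet> t) + 1/(2*L) * (s \<bullet> s)"
    using \<open>L > 0\<close> by (simp add: field_simps power2_eq_square)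
  finally show ?thesis
    using expand[of t' u'] expand[of s' x'] unfolding P' Q' by linarith
qed

text \<open>\<open>n\<close> is the old and \<open>m\<close> the new time level. The two power
  integrals are the right-hand sides of the energy identities and cancel when everything is
  added.\<close>

lemma interface_energy_exchange:
  fixes \<Gamma> :: "(real^'n) set"
  assumes "L > 0" "\<Delta>t > 0"
    and sq: "square_integrable (surface_measure \<Gamma>) (u n)" "square_integrable (surface_measure \<Gamma>) (x n)"
      "square_integrable (surface_measure \<Gamma>) (t n)" "square_integrable (surface_measure \<Gamma>) (s n)"
    and sq': "square_integrable (surface_measure \<Gamma>) (u m)" "square_integrable (surface_measure \<Gamma>) (x m)"
      "square_integrable (surface_measure \<Gamma>) (t m)" "square_integrable (surface_measure \<Gamma>) (s m)"
    and P: "AE y in surface_measure \<Gamma>. L *\<^sub>R u m y + t m y =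
      (L/2) *\<^sub>R u n y + (L/2) *\<^sub>R x n y + (1/2) *\<^sub>R t n y + (1/2) *\<^sub>R (- s n y)"
    and Q: "AE y in surface_measure \<Gamma>. L *\<^sub>R x m y + s m y =
      (L/2) *\<^sub>R u n y + (L/2) *\<^sub>R x n y + (1/2) *\<^sub>R (- t n y) + (1/2) *\<^sub>R s n y"
  shows "\<Delta>t * (\<integral>y. t m y \<bullet> u m y \<partial>surface_measure \<Gamma>) + \<Delta>t * (\<integral>y. s m y \<bullet> x m y \<partial>surface_measure \<Gamma>)
      + interface_energy \<Gamma> L L \<Delta>t u x t s m \<le> interface_energy \<Gamma> L L \<Delta>t u x t s n"
proof -
  let ?M = "surface_measure \<Gamma>"
  let ?e = "\<lambda>k y. L/2 * (u k y \<bullet> u k y) + L/2 * (x k y \<bullet> x k y) + 1/(2*L) * (t k y \<bullet> t k y) + 1/(2*L) * (s k y \<bullet> s k y)"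
  note int = square_integrable_inner[OF sq(1) sq(1)] square_integrable_inner[OF sq(2) sq(2)]
    square_integrable_inner[OF sq(3) sq(3)] square_integrable_inner[OF sq(4) sq(4)]
  note int' = square_integrable_inner[OF sq'(1) sq'(1)] square_integrable_inner[OF sq'(2) sq'(2)]
    square_integrable_inner[OF sq'(3) sq'(3)] square_integrable_inner[OF sq'(4) sq'(4)]
    square_integrable_inner[OF sq'(3) sq'(1)] square_integrable_inner[OF sq'(4) sq'(2)]
  \<comment> \<open>The integral is split only at the two levels where square integrability is
    assumed.\<close>
  have e: "interface_energy \<Gamma> L L \<Delta>t u x t s k = \<Delta>t * (\<integral>y. ?e k y \<partial>?M)" if "k = n \<or> k = m" for k
    using that int int' unfolding interface_energy_def l2norm_power2
    by (auto simp: Bochner_Integration.integral_add field_simps)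
  have "(\<integral>y. t m y \<bullet> u m y + s m y \<bullet> x m y + ?e m y \<partial>?M) \<le> (\<integral>y. ?e n y \<partial>?M)"
  proof (rule integral_mono_AE)
    show "AE y in ?M. t m y \<bullet> u m y + s m y \<bullet> x m y + ?e m y \<le> ?e n y"
      using P Q by eventually_elim (rule Robin_exchange[OF \<open>L > 0\<close>])
  qed (use int int' in \<open>auto intro!: Bochner_Integration.integrable_add integrable_mult_right\<close>)
  moreover have "(\<integral>y. t m y \<bullet> u m y + s m y \<bullet> x m y + ?e m y \<partial>?M)
      = (\<integral>y. t m y \<bullet> u m y \<partial>?M) + (\<integral>y. s m y \<bullet> x m y \<partial>?M) + (\<integral>y. ?e m y \<partial>?M)"
    using int' by (simp add: Bochner_Integration.integral_add)
  ultimately have "\<Delta>t * ((\<integral>y. t m y \<bullet> u m y \<partial>?M) + (\<integral>y. s m y \<bullet> x m y \<partial>?M) + (\<integral>y. ?e m y \<partial>?M))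
      \<le> \<Delta>t * (\<integral>y. ?e n y \<partial>?M)"
    using \<open>\<Delta>t > 0\<close> by (intro mult_left_mono) auto
  then show ?thesis using e[of n] e[of m] by (simp add: distrib_left)
qed

lemma H1_field_square_integrable:
  assumes "H1_field \<Omega> v G g"
  shows "square_integrable (lebesgue_on \<Omega>) v" "square_integrable (surface_measure (frontier \<Omega>)) g"
  using assms by (auto simp: H1_field_def l2_converges_def)

theorem theorem4p3:
  fixes \<Omega>f \<Omega>s \<Gamma> \<Gamma>fD \<Gamma>fN \<Gamma>sD \<Gamma>sN :: "(real^'n::finite) set"
    and nf ns :: "real^'n \<Rightarrow> real^'n"
    and \<rho>f \<mu>f \<rho>s \<mu>s lam_s L1 L2 T \<Delta>t :: real and N :: nat
    and u \<eta> \<xi> u\<Gamma> \<eta>\<Gamma> \<xi>\<Gamma> tf ts :: "nat \<Rightarrow> real^'n \<Rightarrow> real^'n"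
    and Du D\<eta> D\<xi> :: "nat \<Rightarrow> real^'n \<Rightarrow> real^'n^'n"
    and p :: "nat \<Rightarrow> real^'n \<Rightarrow> real"
  assumes dim: "CARD('n) = 2 \<or> CARD('n) = 3"
    and domains: "regular_domain \<Omega>f" "regular_domain \<Omega>s"
    and normals: "outward_unit_normal \<Omega>f nf" "outward_unit_normal \<Omega>s ns"
    and boundary: "boundary_partition \<Omega>f \<Gamma> \<Gamma>fD \<Gamma>fN" "boundary_partition \<Omega>s \<Gamma> \<Gamma>sD \<Gamma>sN"
    and opposite: "AE x in surface_measure \<Gamma>. nf x = - ns x"
    and constants: "\<rho>f > 0" "\<mu>f > 0" "\<rho>s > 0" "\<mu>s > 0" "lam_s > 0" "L1 > 0" "L2 > 0"
    and time: "T > 0" "N \<ge> 1" "\<Delta>t = T / real N"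
    and regularity: 
      "\<forall>n\<le>N. H1_field \<Omega>f (u n) (Du n) (u\<Gamma> n)"
      "\<forall>n\<le>N. square_integrable (lebesgue_on \<Omega>f) (p n)"
      "\<forall>n\<le>N. H1_field \<Omega>s (\<eta> n) (D\<eta> n) (\<eta>\<Gamma> n)"
      "\<forall>n\<le>N. H1_field \<Omega>s (\<xi> n) (D\<xi> n) (\<xi>\<Gamma> n)"
    and initial_tractions:
      "\<exists>f. Hdiv_tensor \<Omega>f nf \<Gamma> (stress_f \<mu>f (Du 0) (p 0)) f (tf 0)"
      "\<exists>f. Hdiv_tensor \<Omega>s ns \<Gamma> (stress_s \<mu>s lam_s (D\<eta> 0)) f (ts 0)"
    and fluid: "\<forall>n<N. fluid_step \<Omega>f nf \<Gamma> \<Gamma>fD \<Gamma>fN \<rho>f \<mu>f L1 \<Delta>t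
        (u n) (u\<Gamma> n) (\<xi>\<Gamma> n) (tf n) (ts n)
        (u (Suc n)) (Du (Suc n)) (u\<Gamma> (Suc n)) (p (Suc n)) (tf (Suc n))"
    and struct: "\<forall>n<N. structure_step \<Omega>s ns \<Gamma> \<Gamma>sD \<Gamma>sN \<rho>s \<mu>s lam_s L2 \<Delta>t
        (\<eta> n) (\<xi> n) (u\<Gamma> n) (\<xi>\<Gamma> n) (tf n) (ts n)
        (\<eta> (Suc n)) (D\<eta> (Suc n)) (\<eta>\<Gamma> (Suc n)) (\<xi> (Suc n)) (\<xi>\<Gamma> (Suc n)) (ts (Suc n))"
    and equal_robin: "L1 = L2"
  shows "energy \<Omega>f \<Omega>s \<rho>f \<rho>s \<mu>s lam_s u D\<eta> \<xi> N
       + (\<Sum>n=1..N. dissipation \<Omega>f \<Omega>s \<rho>f \<mu>f \<rho>s \<mu>s lam_s \<Delta>t u Du D\<eta> \<xi> n)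
       + interface_energy \<Gamma> L1 L2 \<Delta>t u\<Gamma> \<xi>\<Gamma> tf ts N
    \<le> energy \<Omega>f \<Omega>s \<rho>f \<rho>s \<mu>s lam_s u D\<eta> \<xi> 0
       + interface_energy \<Gamma> L1 L2 \<Delta>t u\<Gamma> \<xi>\<Gamma> tf ts 0"
proof -
  have "\<Delta>t > 0" using time by simp
  let ?M = "surface_measure \<Gamma>"
  let ?E = "energy \<Omega>f \<Omega>s \<rho>f \<rho>s \<mu>s lam_s u D\<eta> \<xi>"
  let ?D = "dissipation \<Omega>f \<Omega>s \<rho>f \<mu>f \<rho>s \<mu>s lam_s \<Delta>t u Du D\<eta> \<xi>"
  let ?I = "interface_energy \<Gamma> L1 L2 \<Delta>t u\<Gamma> \<xi>\<Gamma> tf ts"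
  have b: "\<Gamma> \<in> sets borel" "\<Gamma> \<union> \<Gamma>fN \<in> sets borel" "\<Gamma> \<union> \<Gamma>sN \<in> sets borel"
      "frontier \<Omega>f \<in> sets borel" "frontier \<Omega>s \<in> sets borel"
      "\<Gamma> \<subseteq> frontier \<Omega>f" "\<Gamma> \<subseteq> frontier \<Omega>s"
    using boundary by (auto simp: boundary_partition_def borel_closed)
  have traces: "square_integrable ?M (u\<Gamma> n)" "square_integrable ?M (\<xi>\<Gamma> n)" if "n \<le> N" for n
  proof -
    have "square_integrable (surface_measure (frontier \<Omega>f)) (u\<Gamma> n)"
        "square_integrable (surface_measure (frontier \<Omega>s)) (\<xi>\<Gamma> n)"
      using regularity(1,4) that by (auto intro: H1_field_square_integrable)
    then show "square_integrable ?M (u\<Gamma> n)" "square_integrable ?M (\<xi>\<Gamma> n)"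
      by (blast intro: square_integrable_surface_mono[OF b(1,4,6)] square_integrable_surface_mono[OF b(1,5,7)])+
  qed
  \<comment> \<open>The initial traction is given on \<Gamma>; later ones come from the fluid step,
    on the larger set \<Gamma> \<union> \<open>\<Gamma>fN\<close>.\<close>
  have tf: "square_integrable ?M (tf n)" if "n \<le> N" for n
  proof (cases n)
    case 0
    with initial_tractions(1) show ?thesis by (auto simp: Hdiv_tensor_def l2_converges_def)
  next
    case (Suc m)
    with that have "m < N" by simp
    from fluid[rule_format, OF this] have "square_integrable (surface_measure (\<Gamma> \<union> \<Gamma>fN)) (tf n)"
      unfolding Suc fluid_step_def Hdiv_tensor_def l2_converges_def by blast
    then show ?thesis by (rule square_integrable_surface_mono[OF b(1,2) Un_upper1])
  qed
  have ts: "square_integrable ?M (ts n)" if "n \<le> N" for n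
  proof (cases n)
    case 0
    with initial_tractions(2) show ?thesis by (auto simp: Hdiv_tensor_def l2_converges_def)
  next
    case (Suc m)
    with that have "m < N" by simp
    from struct[rule_format, OF this] have "square_integrable (surface_measure (\<Gamma> \<union> \<Gamma>sN)) (ts n)"
      unfolding Suc structure_step_def Hdiv_tensor_def l2_converges_def by blast
    then show ?thesis by (rule square_integrable_surface_mono[OF b(1,3) Un_upper1])
  qed
  \<comment> \<open>The level \<open>n - 1\<close> in \<open>dissipation\<close> is a truncated
    difference; it is used only at successors, where it is the true predecessor.\<close>
  have step: "?E (Suc n) + ?D (Suc n) + ?I (Suc n) \<le> ?E n + ?I n" if "n < N" for n
  proof -
    have n: "n \<le> N" "Suc n \<le> N" using that by auto
    note F = fluid[rule_format, OF that] and S = struct[rule_format, OF that]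
    have sq: "square_integrable (lebesgue_on \<Omega>f) (u n)" "square_integrable (lebesgue_on \<Omega>s) (\<xi> n)"
      using regularity(1,4) n(1) by (auto intro: H1_field_square_integrable)
    note f = fluid_energy_identity[OF domains(1) normals(1) boundary(1) \<open>\<Delta>t > 0\<close> sq(1)
        regularity(1)[rule_format, OF n(2)] F]
    note s = structure_energy_identity[OF domains(2) normals(2) boundary(2) \<open>\<Delta>t > 0\<close>
        regularity(3)[rule_format, OF n(1)] regularity(3)[rule_format, OF n(2)] sq(2)
        regularity(4)[rule_format, OF n(2)] S]
    have "\<Delta>t * (\<integral>y. tf (Suc n) y \<bullet> u\<Gamma> (Suc n) y \<partial>?M) + \<Delta>t * (\<integral>y. ts (Suc n) y \<bullet> \<xi>\<Gamma> (Suc n) y \<partial>?M)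
        + ?I (Suc n) \<le> ?I n"
      unfolding equal_robin
    proof (rule interface_energy_exchange[OF \<open>L2 > 0\<close> \<open>\<Delta>t > 0\<close>])
      show "AE y in ?M. L2 *\<^sub>R u\<Gamma> (Suc n) y + tf (Suc n) y =
          (L2/2) *\<^sub>R u\<Gamma> n y + (L2/2) *\<^sub>R \<xi>\<Gamma> n y + (1/2) *\<^sub>R tf n y + (1/2) *\<^sub>R (- ts n y)"
        using F unfolding fluid_step_def equal_robin by blast
      show "AE y in ?M. L2 *\<^sub>R \<xi>\<Gamma> (Suc n) y + ts (Suc n) y =
          (L2/2) *\<^sub>R u\<Gamma> n y + (L2/2) *\<^sub>R \<xi>\<Gamma> n y + (1/2) *\<^sub>R (- tf n y) + (1/2) *\<^sub>R ts n y"
        using S unfolding structure_step_def by blast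
    qed (use n in \<open>auto intro: traces tf ts\<close>)
    \<comment> \<open>The fluid identity contains the viscous term with factor 2, the dissipation
      with factor 1; the surplus is nonnegative and is dropped.\<close>
    moreover have "0 \<le> \<mu>f * \<Delta>t * (l2norm (lebesgue_on \<Omega>f) (\<lambda>x. sym_grad (Du (Suc n) x)))\<^sup>2"
      using \<open>\<Delta>t > 0\<close> constants by simp
    ultimately show ?thesis
      using f s unfolding energy_def dissipation_def by (simp add: algebra_simps)
  qed
  \<comment> \<open>The steps telescope; at k = 0 the sum is empty and equality holds.\<close>
  have "?E k + (\<Sum>n=1..k. ?D n) + ?I k \<le> ?E 0 + ?I 0" if "k \<le> N" for k
    using that
  proof (induction k)
    case (Suc k)
    then show ?case using step[of k] by simp
  qed simp
  then show ?thesis by simp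
qed

end
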